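(* Let $K_\lambda G$ be an infinite twisted group algebra of a group $G$ over a field $K$ such that $\operatorname{char}(K)$ does not divide the order of any element (of finite order) of the subgroup $\Delta G$. Let $\Delta U$ be the $FC$-center of $U(K_\lambda G)$ and $t(\Delta U)$ the subgroup of all elements of finite order of $\Delta U$. Then $t(\Delta U)$ is abelian.
   Context: Let $G$ be a group, $K$ a field, $U(K)=K\setminus\{0\}$, and $\lambda:G\times G\to U(K)$, $(g,h)\mapsto\lambda_{g,h}$, a $2$-cocycle with respect to the trivial action of $G$, i.e. $\lambda_{g,h}\lambda_{gh,k}=\lambda_{h,k}\lambda_{g,hk}$ for all $g,h,k\in G$. The twisted group algebra $K_\lambda G$ is the associative $K$-algebra with $K$-basis $\{u_g\mid g\in G\}$ and multiplication determined by $u_gu_h=\lambda_{g,h}u_{gh}$ and distributivity. $U(K_\lambda G)$ is its group of units. $\Delta G$ is the $FC$-center of $G$, i.e. the subgroup of all elements of $G$ with finitely many conjugates in $G$. $\Delta U$, the $FC$-center of $U(K_\lambda G)$, is the subgroup of all elements of $U(K_\lambda G)$ having only finitely many conjugates in $U(K_\lambda G)$. The elements of finite order of $\Delta U$ form a normal subgroup $t(\Delta U)$. *)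

theory Defs
  imports "HOL-Algebra.Algebra"
begin

definition two_cocycle :: "('g, 'm) monoid_scheme \<Rightarrow> ('g \<Rightarrow> 'g \<Rightarrow> 'k::field) \<Rightarrow> bool" where
  "two_cocycle G lam \<longleftrightarrow>
     (\<forall>g\<in>carrier G. \<forall>h\<in>carrier G. lam g h \<noteq> 0) \<and>
     (\<forall>g\<in>carrier G. \<forall>h\<in>carrier G. \<forall>k\<in>carrier G.
        lam g h * lam (g \<otimes>\<^bsub>G\<^esub> h) k = lam h k * lam g (h \<otimes>\<^bsub>G\<^esub> k))"

text \<open>
  An element \<open>\<Sum>g. a\<^sub>g u\<^sub>g\<close> is represented by its coefficient function \<open>g \<mapsto> a\<^sub>g\<close>, which has finite
  support contained in \<open>carrier G\<close>. Cocycles are not assumed to be normalized, so the identity is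
  \<open>\<lambda>(1,1)\<^sup>-\<^sup>1 u\<^sub>1\<close> rather than \<open>u\<^sub>1\<close>.
\<close>

definition coeff_support :: "('g \<Rightarrow> 'k::zero) \<Rightarrow> 'g set" where
  "coeff_support a = {g. a g \<noteq> 0}"

definition twisted_group_algebra ::
  "('g, 'm) monoid_scheme \<Rightarrow> ('g \<Rightarrow> 'g \<Rightarrow> 'k::field) \<Rightarrow> ('k, 'g \<Rightarrow> 'k) module" where
  "twisted_group_algebra G lam =
     \<lparr> carrier = {a. finite (coeff_support a) \<and> coeff_support a \<subseteq> carrier G},
       monoid.mult = (\<lambda>a b x. \<Sum>g\<in>coeff_support a. \<Sum>h\<in>coeff_support b.
                 if g \<otimes>\<^bsub>G\<^esub> h = x then a g * b h * lam g h else 0),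
       monoid.one = (\<lambda>x. if x = \<one>\<^bsub>G\<^esub> then inverse (lam \<one>\<^bsub>G\<^esub> \<one>\<^bsub>G\<^esub>) else 0),
       ring.zero = (\<lambda>x. 0),
       ring.add = (\<lambda>a b x. a x + b x),
       module.smult = (\<lambda>c a x. c * a x) \<rparr>"

definition basis_unit :: "'g \<Rightarrow> 'g \<Rightarrow> 'k::field" where
  "basis_unit g = (\<lambda>x. if x = g then 1 else 0)"

definition FC_center :: "('a, 'm) monoid_scheme \<Rightarrow> 'a set" where
  "FC_center G =
     {x \<in> carrier G. finite {g \<otimes>\<^bsub>G\<^esub> x \<otimes>\<^bsub>G\<^esub> inv\<^bsub>G\<^esub> g | g. g \<in> carrier G}}"

text \<open>The library's \<open>group.ord\<close> is \<open>0\<close> exactly on the elements of infinite order.\<close>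

definition finite_order_elements :: "('a, 'm) monoid_scheme \<Rightarrow> 'a set \<Rightarrow> 'a set" where
  "finite_order_elements G H = {x \<in> H. group.ord G x \<noteq> 0}"

lemma tga_mult_superset:
  assumes "finite A" "finite B" "coeff_support a \<subseteq> A" "coeff_support b \<subseteq> B"
  shows "monoid.mult (twisted_group_algebra G lam) a b x =
    (\<Sum>g\<in>A. \<Sum>h\<in>B. if g \<otimes>\<^bsub>G\<^esub> h = x then a g * b h * lam g h else 0)"
proof -
  have "(\<Sum>g\<in>A. \<Sum>h\<in>B. if g \<otimes>\<^bsub>G\<^esub> h = x then a g * b h * lam g h else 0)
      = (\<Sum>g\<in>coeff_support a. \<Sum>h\<in>B. if g \<otimes>\<^bsub>G\<^esub> h = x then a g * b h * lam g h else 0)"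
    by (rule sum.mono_neutral_right[OF assms(1,3)])
       (auto simp: coeff_support_def intro!: sum.neutral split: if_splits)
  also have "\<dots> = (\<Sum>g\<in>coeff_support a. \<Sum>h\<in>coeff_support b.
      if g \<otimes>\<^bsub>G\<^esub> h = x then a g * b h * lam g h else 0)"
    by (intro sum.cong refl sum.mono_neutral_right[OF assms(2,4)])
       (auto simp: coeff_support_def)
  finally show ?thesis
    by (simp add: twisted_group_algebra_def)
qed

lemma tga_mult_support:
  "coeff_support (monoid.mult (twisted_group_algebra G lam) a b)
     \<subseteq> (\<lambda>(g, h). g \<otimes>\<^bsub>G\<^esub> h) ` (coeff_support a \<times> coeff_support b)"
proof
  fix x assume "x \<in> coeff_support (monoid.mult (twisted_group_algebra G lam) a b)"
  then have "(\<Sum>g\<in>coeff_support a. \<Sum>h\<in>coeff_support b.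
      if g \<otimes>\<^bsub>G\<^esub> h = x then a g * b h * lam g h else 0) \<noteq> 0"
    by (simp add: coeff_support_def twisted_group_algebra_def)
  then obtain g where g: "g \<in> coeff_support a"
    and "(\<Sum>h\<in>coeff_support b. if g \<otimes>\<^bsub>G\<^esub> h = x then a g * b h * lam g h else 0) \<noteq> 0"
    by (rule sum.not_neutral_contains_not_neutral)
  then obtain h where h: "h \<in> coeff_support b"
    and "(if g \<otimes>\<^bsub>G\<^esub> h = x then a g * b h * lam g h else 0) \<noteq> 0"
    by (elim sum.not_neutral_contains_not_neutral)
  then have "x = g \<otimes>\<^bsub>G\<^esub> h" by (auto split: if_splits)
  with g h show "x \<in> (\<lambda>(g, h). g \<otimes>\<^bsub>G\<^esub> h) ` (coeff_support a \<times> coeff_support b)" by auto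
qed

lemma tga_mult_closed:
  assumes "group G"
    and a: "a \<in> carrier (twisted_group_algebra G lam)"
    and b: "b \<in> carrier (twisted_group_algebra G lam)"
  shows "monoid.mult (twisted_group_algebra G lam) a b \<in> carrier (twisted_group_algebra G lam)"
proof -
  interpret group G by fact
  let ?ab = "monoid.mult (twisted_group_algebra G lam) a b"
  let ?P = "(\<lambda>(g, h). g \<otimes>\<^bsub>G\<^esub> h) ` (coeff_support a \<times> coeff_support b)"
  from a b have "finite ?P" "?P \<subseteq> carrier G"
    by (auto simp: twisted_group_algebra_def)
  with tga_mult_support[of G lam a b]
  have "finite (coeff_support ?ab)" "coeff_support ?ab \<subseteq> carrier G"
    using finite_subset by blast+
  then show ?thesis by (simp add: twisted_group_algebra_def)
qed

lemma sum_move_inside2: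
  "(\<Sum>d\<in>D. \<Sum>g\<in>A. \<Sum>h\<in>B. F d g h) = (\<Sum>g\<in>A. \<Sum>h\<in>B. \<Sum>d\<in>D. F d g h)"
  by (simp only: sum.swap[where B = D])

lemma sum_move_inside3:
  "(\<Sum>d\<in>D. \<Sum>k\<in>C. \<Sum>g\<in>A. \<Sum>h\<in>B. F d k g h)
     = (\<Sum>k\<in>C. \<Sum>g\<in>A. \<Sum>h\<in>B. \<Sum>d\<in>D. F d k g h)"
  by (simp only: sum.swap[where B = D])

lemma if_sum_distrib:
  fixes r :: "'k::field"
  shows "(if P then l * (\<Sum>g\<in>A. \<Sum>h\<in>B. if Q g h then F g h else 0) * r else 0)
     = (\<Sum>g\<in>A. \<Sum>h\<in>B. if Q g h then (if P then l * F g h * r else 0) else 0)"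
proof (cases P)
  case True
  have "l * (if Q g h then F g h else 0) * r = (if Q g h then l * F g h * r else 0)" for g h
    by simp
  with True show ?thesis by (simp only: if_True sum_distrib_left sum_distrib_right)
qed (simp cong: if_cong)

lemma tga_mult_assoc:
  assumes "group G" "two_cocycle G lam"
    and a: "a \<in> carrier (twisted_group_algebra G lam)"
    and b: "b \<in> carrier (twisted_group_algebra G lam)"
    and c: "c \<in> carrier (twisted_group_algebra G lam)"
  shows "monoid.mult (twisted_group_algebra G lam) (monoid.mult (twisted_group_algebra G lam) a b) c =
         monoid.mult (twisted_group_algebra G lam) a (monoid.mult (twisted_group_algebra G lam) b c)"
proof
  fix x
  interpret group G by fact
  let ?m = "monoid.mult (twisted_group_algebra G lam)"
  let ?A = "coeff_support a" and ?B = "coeff_support b" and ?C = "coeff_support c"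
  let ?D = "(\<lambda>(g, h). g \<otimes>\<^bsub>G\<^esub> h) ` (?A \<times> ?B)"
  let ?E = "(\<lambda>(g, h). g \<otimes>\<^bsub>G\<^esub> h) ` (?B \<times> ?C)"
  have fin: "finite ?A" "finite ?B" "finite ?C" "finite ?D" "finite ?E"
    and sub: "?A \<subseteq> carrier G" "?B \<subseteq> carrier G" "?C \<subseteq> carrier G"
    using a b c by (auto simp: twisted_group_algebra_def)
  have ab: "?m a b d = (\<Sum>g\<in>?A. \<Sum>h\<in>?B. if g \<otimes>\<^bsub>G\<^esub> h = d then a g * b h * lam g h else 0)" for d
    by (simp add: twisted_group_algebra_def)
  have bc: "?m b c d = (\<Sum>g\<in>?B. \<Sum>h\<in>?C. if g \<otimes>\<^bsub>G\<^esub> h = d then b g * c h * lam g h else 0)" for d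
    by (simp add: twisted_group_algebra_def)
  have "?m (?m a b) c x
      = (\<Sum>d\<in>?D. \<Sum>k\<in>?C. if d \<otimes>\<^bsub>G\<^esub> k = x then ?m a b d * c k * lam d k else 0)"
    by (rule tga_mult_superset[OF fin(4,3) tga_mult_support subset_refl])
  also have "\<dots> = (\<Sum>d\<in>?D. \<Sum>k\<in>?C. \<Sum>g\<in>?A. \<Sum>h\<in>?B. if g \<otimes>\<^bsub>G\<^esub> h = d
      then (if d \<otimes>\<^bsub>G\<^esub> k = x then a g * b h * lam g h * c k * lam d k else 0) else 0)"
    unfolding ab
    by (simp only: if_sum_distrib[where l = 1, simplified mult_1_left mult.assoc] mult.assoc)
  also have "\<dots> = (\<Sum>k\<in>?C. \<Sum>g\<in>?A. \<Sum>h\<in>?B. \<Sum>d\<in>?D. if g \<otimes>\<^bsub>G\<^esub> h = d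
      then (if d \<otimes>\<^bsub>G\<^esub> k = x then a g * b h * lam g h * c k * lam d k else 0) else 0)"
    by (rule sum_move_inside3)
  also have "\<dots> = (\<Sum>k\<in>?C. \<Sum>g\<in>?A. \<Sum>h\<in>?B. if g \<otimes>\<^bsub>G\<^esub> h \<otimes>\<^bsub>G\<^esub> k = x
      then a g * b h * lam g h * c k * lam (g \<otimes>\<^bsub>G\<^esub> h) k else 0)"
    using fin by (intro sum.cong refl) (simp add: sum.delta', force)
  also have "\<dots> = (\<Sum>k\<in>?C. \<Sum>g\<in>?A. \<Sum>h\<in>?B. if g \<otimes>\<^bsub>G\<^esub> (h \<otimes>\<^bsub>G\<^esub> k) = x
      then a g * b h * c k * lam h k * lam g (h \<otimes>\<^bsub>G\<^esub> k) else 0)"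
  proof (intro sum.cong refl)
    fix k g h assume "k \<in> ?C" "g \<in> ?A" "h \<in> ?B"
    with sub have *: "g \<in> carrier G" "h \<in> carrier G" "k \<in> carrier G" by auto
    then have "lam g h * lam (g \<otimes>\<^bsub>G\<^esub> h) k = lam h k * lam g (h \<otimes>\<^bsub>G\<^esub> k)"
      using assms(2) by (simp add: two_cocycle_def)
    then have "a g * b h * lam g h * c k * lam (g \<otimes>\<^bsub>G\<^esub> h) k
        = a g * b h * c k * lam h k * lam g (h \<otimes>\<^bsub>G\<^esub> k)"
      by (simp add: ac_simps)
    with * show "(if g \<otimes>\<^bsub>G\<^esub> h \<otimes>\<^bsub>G\<^esub> k = x
        then a g * b h * lam g h * c k * lam (g \<otimes>\<^bsub>G\<^esub> h) k else 0) =
      (if g \<otimes>\<^bsub>G\<^esub> (h \<otimes>\<^bsub>G\<^esub> k) = x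
        then a g * b h * c k * lam h k * lam g (h \<otimes>\<^bsub>G\<^esub> k) else 0)"
      by (simp add: m_assoc)
  qed
  also have "\<dots> = (\<Sum>g\<in>?A. \<Sum>h\<in>?B. \<Sum>k\<in>?C. if g \<otimes>\<^bsub>G\<^esub> (h \<otimes>\<^bsub>G\<^esub> k) = x
      then a g * b h * c k * lam h k * lam g (h \<otimes>\<^bsub>G\<^esub> k) else 0)"
    by (rule sum_move_inside2)
  also have "\<dots> = (\<Sum>g\<in>?A. \<Sum>h\<in>?B. \<Sum>k\<in>?C. \<Sum>e\<in>?E. if h \<otimes>\<^bsub>G\<^esub> k = e
      then (if g \<otimes>\<^bsub>G\<^esub> e = x then a g * (b h * c k * lam h k) * lam g e else 0) else 0)"
    using fin by (intro sum.cong refl) (simp add: sum.delta' mult.assoc, force)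
  also have "\<dots> = (\<Sum>g\<in>?A. \<Sum>e\<in>?E. \<Sum>h\<in>?B. \<Sum>k\<in>?C. if h \<otimes>\<^bsub>G\<^esub> k = e
      then (if g \<otimes>\<^bsub>G\<^esub> e = x then a g * (b h * c k * lam h k) * lam g e else 0) else 0)"
    by (intro sum.cong refl sum_move_inside2[symmetric])
  also have "\<dots> = (\<Sum>g\<in>?A. \<Sum>e\<in>?E. if g \<otimes>\<^bsub>G\<^esub> e = x then a g * ?m b c e * lam g e else 0)"
    unfolding bc by (intro sum.cong refl if_sum_distrib[symmetric])
  also have "\<dots> = ?m a (?m b c) x"
    by (rule tga_mult_superset[OF fin(1,5) subset_refl tga_mult_support, symmetric])
  finally show "?m (?m a b) c x = ?m a (?m b c) x" .
qed

lemma two_cocycle_one: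
  assumes "group G" "two_cocycle G lam" "k \<in> carrier G"
  shows "lam \<one>\<^bsub>G\<^esub> k = lam \<one>\<^bsub>G\<^esub> \<one>\<^bsub>G\<^esub>" "lam k \<one>\<^bsub>G\<^esub> = lam \<one>\<^bsub>G\<^esub> \<one>\<^bsub>G\<^esub>"
proof -
  interpret group G by fact
  have nz: "\<And>g h. g \<in> carrier G \<Longrightarrow> h \<in> carrier G \<Longrightarrow> lam g h \<noteq> 0"
    and co: "\<And>g h k. g \<in> carrier G \<Longrightarrow> h \<in> carrier G \<Longrightarrow> k \<in> carrier G \<Longrightarrow>
      lam g h * lam (g \<otimes>\<^bsub>G\<^esub> h) k = lam h k * lam g (h \<otimes>\<^bsub>G\<^esub> k)"
    using assms(2) by (auto simp: two_cocycle_def)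
  show "lam \<one>\<^bsub>G\<^esub> k = lam \<one>\<^bsub>G\<^esub> \<one>\<^bsub>G\<^esub>"
    using co[of "\<one>\<^bsub>G\<^esub>" "\<one>\<^bsub>G\<^esub>" k] nz[of "\<one>\<^bsub>G\<^esub>" k] assms(3) by simp
  show "lam k \<one>\<^bsub>G\<^esub> = lam \<one>\<^bsub>G\<^esub> \<one>\<^bsub>G\<^esub>"
    using co[of k "\<one>\<^bsub>G\<^esub>" "\<one>\<^bsub>G\<^esub>"] nz[of k "\<one>\<^bsub>G\<^esub>"] assms(3) by simp
qed

lemma tga_one_mult:
  assumes "group G" "two_cocycle G lam" "a \<in> carrier (twisted_group_algebra G lam)"
  shows "monoid.mult (twisted_group_algebra G lam) (monoid.one (twisted_group_algebra G lam)) a = a"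
    and "monoid.mult (twisted_group_algebra G lam) a (monoid.one (twisted_group_algebra G lam)) = a"
proof -
  interpret group G by fact
  let ?A = "coeff_support a" and ?e = "monoid.one (twisted_group_algebra G lam)"
  have fin: "finite ?A" and sub: "?A \<subseteq> carrier G"
    using assms(3) by (auto simp: twisted_group_algebra_def)
  have e: "coeff_support ?e \<subseteq> {\<one>\<^bsub>G\<^esub>}" "?e \<one>\<^bsub>G\<^esub> = inverse (lam \<one>\<^bsub>G\<^esub> \<one>\<^bsub>G\<^esub>)"
    by (auto simp: twisted_group_algebra_def coeff_support_def)
  have nz: "lam \<one>\<^bsub>G\<^esub> \<one>\<^bsub>G\<^esub> \<noteq> 0"
    using assms(2) by (auto simp: two_cocycle_def)
  show "monoid.mult (twisted_group_algebra G lam) ?e a = a"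
  proof
    fix x
    have "monoid.mult (twisted_group_algebra G lam) ?e a x
        = (\<Sum>g\<in>{\<one>\<^bsub>G\<^esub>}. \<Sum>h\<in>?A. if g \<otimes>\<^bsub>G\<^esub> h = x then ?e g * a h * lam g h else 0)"
      by (rule tga_mult_superset) (use fin e in auto)
    also have "\<dots> = (\<Sum>h\<in>?A. if h = x then a h else 0)"
    proof -
      have "(if \<one>\<^bsub>G\<^esub> \<otimes>\<^bsub>G\<^esub> h = x then ?e \<one>\<^bsub>G\<^esub> * a h * lam \<one>\<^bsub>G\<^esub> h else 0) = (if h = x then a h else 0)" if "h \<in> ?A" for h
      proof -
        have "h \<in> carrier G" using sub that by auto
        then have "lam \<one>\<^bsub>G\<^esub> h = lam \<one>\<^bsub>G\<^esub> \<one>\<^bsub>G\<^esub>" "\<one>\<^bsub>G\<^esub> \<otimes>\<^bsub>G\<^esub> h = h"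
          by (simp_all only: two_cocycle_one(1)[OF assms(1,2)] l_one r_one)
        then have "(if \<one>\<^bsub>G\<^esub> \<otimes>\<^bsub>G\<^esub> h = x then ?e \<one>\<^bsub>G\<^esub> * a h * lam \<one>\<^bsub>G\<^esub> h else 0) = (if h = x then ?e \<one>\<^bsub>G\<^esub> * a h * lam \<one>\<^bsub>G\<^esub> \<one>\<^bsub>G\<^esub> else 0)" by (simp only:)
        then show ?thesis using nz e(2) by simp
      qed
      then have "(\<Sum>h\<in>?A. (if \<one>\<^bsub>G\<^esub> \<otimes>\<^bsub>G\<^esub> h = x then ?e \<one>\<^bsub>G\<^esub> * a h * lam \<one>\<^bsub>G\<^esub> h else 0)) = (\<Sum>h\<in>?A. if h = x then a h else 0)"
        by (rule sum.cong[OF refl])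
      then show ?thesis by simp
    qed
  also have "\<dots> = a x"
      using fin by (simp add: sum.delta) (simp add: coeff_support_def)
    finally show "monoid.mult (twisted_group_algebra G lam) ?e a x = a x" .
  qed
  show "monoid.mult (twisted_group_algebra G lam) a ?e = a"
  proof
    fix x
    have "monoid.mult (twisted_group_algebra G lam) a ?e x
        = (\<Sum>g\<in>?A. \<Sum>h\<in>{\<one>\<^bsub>G\<^esub>}. if g \<otimes>\<^bsub>G\<^esub> h = x then a g * ?e h * lam g h else 0)"
      by (rule tga_mult_superset) (use fin e in auto)
    also have "\<dots> = (\<Sum>h\<in>?A. if h = x then a h else 0)"
    proof -
      have "(if h \<otimes>\<^bsub>G\<^esub> \<one>\<^bsub>G\<^esub> = x then a h * ?e \<one>\<^bsub>G\<^esub> * lam h \<one>\<^bsub>G\<^esub> else 0) = (if h = x then a h else 0)" if "h \<in> ?A" for h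
      proof -
        have "h \<in> carrier G" using sub that by auto
        then have "lam h \<one>\<^bsub>G\<^esub> = lam \<one>\<^bsub>G\<^esub> \<one>\<^bsub>G\<^esub>" "h \<otimes>\<^bsub>G\<^esub> \<one>\<^bsub>G\<^esub> = h"
          by (simp_all only: two_cocycle_one(2)[OF assms(1,2)] l_one r_one)
        then have "(if h \<otimes>\<^bsub>G\<^esub> \<one>\<^bsub>G\<^esub> = x then a h * ?e \<one>\<^bsub>G\<^esub> * lam h \<one>\<^bsub>G\<^esub> else 0) = (if h = x then a h * ?e \<one>\<^bsub>G\<^esub> * lam \<one>\<^bsub>G\<^esub> \<one>\<^bsub>G\<^esub> else 0)" by (simp only:)
        then show ?thesis using nz e(2) by simp
      qed
      then have "(\<Sum>h\<in>?A. (if h \<otimes>\<^bsub>G\<^esub> \<one>\<^bsub>G\<^esub> = x then a h * ?e \<one>\<^bsub>G\<^esub> * lam h \<one>\<^bsub>G\<^esub> else 0)) = (\<Sum>h\<in>?A. if h = x then a h else 0)"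
        by (rule sum.cong[OF refl])
      then show ?thesis by simp
    qed
  also have "\<dots> = a x"
      using fin by (simp add: sum.delta) (simp add: coeff_support_def)
    finally show "monoid.mult (twisted_group_algebra G lam) a ?e x = a x" .
  qed
qed

lemma tga_add_closed:
  assumes "a \<in> carrier (twisted_group_algebra G lam)" "b \<in> carrier (twisted_group_algebra G lam)"
  shows "ring.add (twisted_group_algebra G lam) a b \<in> carrier (twisted_group_algebra G lam)"
proof -
  have "coeff_support (\<lambda>x. a x + b x) \<subseteq> coeff_support a \<union> coeff_support b"
    by (auto simp: coeff_support_def)
  with assms show ?thesis
    by (auto simp: twisted_group_algebra_def intro: finite_subset)
qed

lemma tga_distrib:
  assumes a: "a \<in> carrier (twisted_group_algebra G lam)"
    and b: "b \<in> carrier (twisted_group_algebra G lam)"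
    and c: "c \<in> carrier (twisted_group_algebra G lam)"
  shows "monoid.mult (twisted_group_algebra G lam) (ring.add (twisted_group_algebra G lam) a b) c =
         ring.add (twisted_group_algebra G lam) (monoid.mult (twisted_group_algebra G lam) a c)
           (monoid.mult (twisted_group_algebra G lam) b c)"
    and "monoid.mult (twisted_group_algebra G lam) c (ring.add (twisted_group_algebra G lam) a b) =
         ring.add (twisted_group_algebra G lam) (monoid.mult (twisted_group_algebra G lam) c a)
           (monoid.mult (twisted_group_algebra G lam) c b)"
proof -
  let ?R = "twisted_group_algebra G lam"
  let ?S = "coeff_support a \<union> coeff_support b" and ?C = "coeff_support c"
  have fin: "finite ?S" "finite ?C"
    using a b c by (auto simp: twisted_group_algebra_def)
  have s: "coeff_support (ring.add ?R a b) \<subseteq> ?S"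
    by (auto simp: twisted_group_algebra_def coeff_support_def)
  have add: "ring.add ?R u v = (\<lambda>x. u x + v x)" for u v
    by (simp add: twisted_group_algebra_def)
  have l: "monoid.mult ?R u c x
      = (\<Sum>g\<in>?S. \<Sum>h\<in>?C. if g \<otimes>\<^bsub>G\<^esub> h = x then u g * c h * lam g h else 0)"
    if "coeff_support u \<subseteq> ?S" for u x
    using fin that by (intro tga_mult_superset) simp_all
  have r: "monoid.mult ?R c u x
      = (\<Sum>g\<in>?C. \<Sum>h\<in>?S. if g \<otimes>\<^bsub>G\<^esub> h = x then c g * u h * lam g h else 0)"
    if "coeff_support u \<subseteq> ?S" for u x
    using fin that by (intro tga_mult_superset) simp_all
  show "monoid.mult ?R (ring.add ?R a b) c = ring.add ?R (monoid.mult ?R a c) (monoid.mult ?R b c)"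
  proof
    fix x
    have "monoid.mult ?R (ring.add ?R a b) c x
        = (\<Sum>g\<in>?S. \<Sum>h\<in>?C. if g \<otimes>\<^bsub>G\<^esub> h = x then (a g + b g) * c h * lam g h else 0)"
      unfolding l[OF s] by (simp only: add)
    also have "\<dots> = (\<Sum>g\<in>?S. \<Sum>h\<in>?C.
        (if g \<otimes>\<^bsub>G\<^esub> h = x then a g * c h * lam g h else 0)
        + (if g \<otimes>\<^bsub>G\<^esub> h = x then b g * c h * lam g h else 0))"
      by (intro sum.cong refl) (simp add: algebra_simps)
    also have "\<dots> = monoid.mult ?R a c x + monoid.mult ?R b c x"
      by (simp only: sum.distrib l[OF Un_upper1] l[OF Un_upper2])
    finally show "monoid.mult ?R (ring.add ?R a b) c x = ring.add ?R (monoid.mult ?R a c) (monoid.mult ?R b c) x"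
      by (simp only: add)
  qed
  show "monoid.mult ?R c (ring.add ?R a b) = ring.add ?R (monoid.mult ?R c a) (monoid.mult ?R c b)"
  proof
    fix x
    have "monoid.mult ?R c (ring.add ?R a b) x
        = (\<Sum>g\<in>?C. \<Sum>h\<in>?S. if g \<otimes>\<^bsub>G\<^esub> h = x then c g * (a h + b h) * lam g h else 0)"
      unfolding r[OF s] by (simp only: add)
    also have "\<dots> = (\<Sum>g\<in>?C. \<Sum>h\<in>?S.
        (if g \<otimes>\<^bsub>G\<^esub> h = x then c g * a h * lam g h else 0)
        + (if g \<otimes>\<^bsub>G\<^esub> h = x then c g * b h * lam g h else 0))"
      by (intro sum.cong refl) (simp add: algebra_simps)
    also have "\<dots> = monoid.mult ?R c a x + monoid.mult ?R c b x"
      by (simp only: sum.distrib r[OF Un_upper1] r[OF Un_upper2])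
    finally show "monoid.mult ?R c (ring.add ?R a b) x = ring.add ?R (monoid.mult ?R c a) (monoid.mult ?R c b) x"
      by (simp only: add)
  qed
qed

lemma tga_abelian_group: "abelian_group (twisted_group_algebra G lam)"
proof (rule abelian_groupI)
  let ?R = "twisted_group_algebra G lam"
  show "ring.add ?R x y \<in> carrier ?R" if "x \<in> carrier ?R" "y \<in> carrier ?R" for x y
    using that by (rule tga_add_closed)
  show "ring.zero ?R \<in> carrier ?R"
    by (simp add: twisted_group_algebra_def coeff_support_def)
  show "\<exists>y\<in>carrier ?R. ring.add ?R y x = ring.zero ?R" if "x \<in> carrier ?R" for x
    by (rule bexI[of _ "\<lambda>g. - x g"])
       (use that in \<open>simp_all add: twisted_group_algebra_def coeff_support_def\<close>)
qed (simp_all add: twisted_group_algebra_def add_ac)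

theorem tga_ring:
  assumes "group G" "two_cocycle G lam"
  shows "ring (twisted_group_algebra G lam)"
proof (rule ringI)
  let ?R = "twisted_group_algebra G lam"
  interpret group G by fact
  show "abelian_group ?R" by (rule tga_abelian_group)
  show "monoid ?R"
  proof (rule monoidI)
    have "coeff_support (monoid.one ?R) \<subseteq> {\<one>\<^bsub>G\<^esub>}"
      by (auto simp: twisted_group_algebra_def coeff_support_def)
    then have "finite (coeff_support (monoid.one ?R))" "coeff_support (monoid.one ?R) \<subseteq> carrier G"
      by (auto intro: finite_subset)
    then show "monoid.one ?R \<in> carrier ?R" by (simp add: twisted_group_algebra_def)
  qed (use assms in \<open>auto intro: tga_mult_closed tga_mult_assoc tga_one_mult\<close>)
qed (auto intro: tga_distrib)

lemma tga_basis_mult: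
  fixes lam :: "'g \<Rightarrow> 'g \<Rightarrow> 'k::field"
  shows "monoid.mult (twisted_group_algebra G lam) (basis_unit g) (basis_unit h) =
   module.smult (twisted_group_algebra G lam) (lam g h) (basis_unit (g \<otimes>\<^bsub>G\<^esub> h))"
proof -
  have "coeff_support (basis_unit g :: 'g \<Rightarrow> 'k) = {g}" for g :: 'g
    by (auto simp: coeff_support_def basis_unit_def)
  then show ?thesis
    by (auto simp: twisted_group_algebra_def basis_unit_def fun_eq_iff)
qed

lemma tga_basis_expansion:
  assumes "a \<in> carrier (twisted_group_algebra G lam)"
  shows "a = (\<lambda>x. \<Sum>g\<in>coeff_support a. a g * basis_unit g x)"
proof
  fix x
  have "finite (coeff_support a)"
    using assms by (simp add: twisted_group_algebra_def)
  then have "(\<Sum>g\<in>coeff_support a. if x = g then a g else 0) = a x"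
    by (simp add: sum.delta') (simp add: coeff_support_def)
  moreover have "(\<Sum>g\<in>coeff_support a. a g * basis_unit g x)
      = (\<Sum>g\<in>coeff_support a. if x = g then a g else 0)"
    by (auto simp: basis_unit_def intro!: sum.cong)
  ultimately show "a x = (\<Sum>g\<in>coeff_support a. a g * basis_unit g x)" by simp
qed

end

theory Submission
  imports Defs "HOL-Computational_Algebra.Polynomial"
begin

text \<open>
  Let \<open>x\<close>, \<open>y\<close> be elements of \<open>t(\<Delta>U)\<close>. If \<open>w\<^sub>i = b + \<tau>\<^sub>i a\<close> is an infinite family of units in which
  \<open>\<tau>\<^sub>i\<close> commutes with the finitely many conjugates of \<open>x\<close>, then infinitely many \<open>w\<^sub>i\<close> conjugate \<open>x\<close>
  into the same \<open>z\<close>, and \<open>w\<^sub>i x = z w\<^sub>i\<close> splits into \<open>a x = z a\<close> and \<open>b x = z b\<close>.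

  If \<open>K\<close> is infinite, the units \<open>1 - c y\<close> with \<open>c \<in> K\<close> give \<open>x y = y x\<close> at once. If \<open>K\<close> is finite, then
  \<open>G\<close> is infinite, and suitable \<open>\<tau>\<^sub>g = u\<^sub>k\<^sup>-\<^sup>1 u\<^sub>g\<close> commute with all conjugates of \<open>x\<close> and \<open>y\<close>. By
  Dietzmann's lemma these conjugates generate a finite ring \<open>A\<close>. The units \<open>1 + \<tau>\<^sub>g a\<close> for nilpotent \<open>a\<close>
  and \<open>(1 - a) + \<tau>\<^sub>g a\<close> for idempotent \<open>a\<close> show that all nilpotents and idempotents of \<open>A\<close> are central
  in \<open>A\<close>. A finite ring of prime characteristic with this property is commutative, by a variant of
  the proof of Wedderburn's theorem on finite division rings.
\<close>

section \<open>Rings as subsets of a type\<close>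

text \<open>The rigidity used throughout is that of a finite conjugacy class against an infinite
  family of units. Over a finite field the scalars run out and the basis elements \<open>u_g\<close>
  take their place, though they need not commute with \<open>x\<close>. They permute the finitely
  many conjugates, so infinitely many \<open>g\<close> act like one fixed \<open>k\<close>, and
  \<open>u_k^-1 u_g\<close> acts trivially. Splitting also needs that \<open>\<tau> v = w\<close>
  for infinitely many \<open>\<tau>\<close> forces \<open>v = 0\<close>; for a nonzero
  \<open>v\<close> the translated supports would sweep out infinitely many group elements.

  Nilpotents and idempotents say nothing about a division ring, so the last step has to contain
  Wedderburn's theorem. A minimal counterexample contains a finite field \<open>E\<close> and a unit
  \<open>r\<close> inducing on it an automorphism of order \<open>d\<close>. Counting makes
  \<open>c \<mapsto> (c r)^d\<close> reach every nonzero element of the fixed field, while reaching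
  the identity would make \<open>c r - e\<close> nilpotent, hence central.

  Subrings carry their own identity \<open>e\<close>, and \<open>a ^ 0 = 1\<close> may lie outside
  them; this explains the positive exponents and the extra factors \<open>e\<close>.\<close>

definition subrng :: "'a::ring_1 set \<Rightarrow> bool" where
  "subrng A \<longleftrightarrow> 0 \<in> A \<and> (\<forall>a\<in>A. \<forall>b\<in>A. a - b \<in> A \<and> a * b \<in> A)"

definition commutative_on :: "'a::ring_1 set \<Rightarrow> bool" where
  "commutative_on A \<longleftrightarrow> (\<forall>a\<in>A. \<forall>b\<in>A. a * b = b * a)"

lemma subrng_closed:
  assumes "subrng A"
  shows subrng_0: "0 \<in> A"
    and subrng_diff: "\<And>a b. a \<in> A \<Longrightarrow> b \<in> A \<Longrightarrow> a - b \<in> A"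
    and subrng_mult: "\<And>a b. a \<in> A \<Longrightarrow> b \<in> A \<Longrightarrow> a * b \<in> A"
    and subrng_uminus: "\<And>a. a \<in> A \<Longrightarrow> - a \<in> A"
    and subrng_add: "\<And>a b. a \<in> A \<Longrightarrow> b \<in> A \<Longrightarrow> a + b \<in> A"
proof -
  show z: "0 \<in> A" and d: "\<And>a b. a \<in> A \<Longrightarrow> b \<in> A \<Longrightarrow> a - b \<in> A"
    and "\<And>a b. a \<in> A \<Longrightarrow> b \<in> A \<Longrightarrow> a * b \<in> A"
    using assms by (auto simp: subrng_def)
  show u: "- a \<in> A" if "a \<in> A" for a using d[OF z that] by simp
  show "a + b \<in> A" if "a \<in> A" "b \<in> A" for a b using d[OF that(1) u[OF that(2)]] by simp
qed

lemma subrng_power: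
  assumes "subrng A" "a \<in> A" "n > 0"
  shows "a ^ n \<in> A"
  using assms(3)
proof (induction n)
  case (Suc n)
  then show ?case using subrng_mult[OF assms(1)] assms(2) by (cases n) auto
qed simp

lemma subrng_sum:
  assumes "subrng A" "\<And>i. i \<in> I \<Longrightarrow> f i \<in> A"
  shows "sum f I \<in> A"
  using assms(2)
  by (induction I rule: infinite_finite_induct) (auto intro: subrng_0 subrng_add assms(1))

lemma subrng_mult_power:
  assumes "subrng A" "a \<in> A" "b \<in> A"
  shows "a * b ^ n \<in> A" and "b ^ n * a \<in> A"
  using assms subrng_power[OF assms(1,3), of n] subrng_mult[OF assms(1)] by (cases n; auto)+

lemma power_commute_left:
  fixes a b :: "'a::monoid_mult"
  assumes "a * b = b * a"
  shows "a ^ n * b = b * a ^ n"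
  using power_commuting_commutes[OF assms, of n] .

lemma power_mult_distrib_commuting:
  fixes a b :: "'a::monoid_mult"
  assumes "a * b = b * a"
  shows "(a * b) ^ n = a ^ n * b ^ n"
proof (induction n)
  case (Suc n)
  have "(a * b) ^ Suc n = a * (b * a ^ n) * b ^ n"
    by (simp only: power_Suc Suc mult.assoc)
  also have "b * a ^ n = a ^ n * b" by (rule power_commute_left[OF assms, symmetric])
  finally show ?case by (simp add: mult.assoc)
qed simp

text \<open>A repeated value makes \<open>h\<close> periodic from some index on, and any multiple of
  the period beyond that index will do. Used for the powers of one element and for the iterates of
  the \<open>p\<close>-th power map.\<close>

lemma eventually_periodic_idempotent:
  fixes h :: "nat \<Rightarrow> 'b"
  assumes "finite (range h)" and shift: "\<And>i j k. h i = h j \<Longrightarrow> h (i + k) = h (j + k)"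
  shows "\<exists>n>0. h (n + n) = h n"
proof -
  have "\<not> inj h" using assms(1) finite_imageD by blast
  then obtain i j where ij: "i < j" "h i = h j"
    unfolding inj_on_def by (metis linorder_neqE_nat)
  define d where "d = j - i"
  have d: "d > 0" "j = i + d" using ij by (auto simp: d_def)
  have step: "h (k + d) = h k" if "k \<ge> i" for k
    using shift[OF ij(2), of "k - i"] that d by (simp add: algebra_simps)
  have per: "h (k + d * l) = h k" if "k \<ge> i" for k l
  proof (induction l)
    case (Suc l)
    have "h (k + d * Suc l) = h ((k + d * l) + d)" by (simp add: algebra_simps)
    then show ?case using step[of "k + d * l"] Suc that by simp
  qed simp
  have "i \<le> d * Suc i" using d(1) by (cases d) auto
  from per[OF this, of "Suc i"] show ?thesis using d(1) by (intro exI[of _ "d * Suc i"]) simp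
qed

lemma finite_power_idempotent:
  fixes a :: "'a::ring_1"
  assumes "finite A" "subrng A" "a \<in> A"
  shows "\<exists>n>0. a ^ n * a ^ n = a ^ n"
proof -
  have "range (\<lambda>n. a ^ n) \<subseteq> insert 1 A"
  proof
    fix x assume "x \<in> range (\<lambda>n. a ^ n)"
    then obtain n where "x = a ^ n" by auto
    then show "x \<in> insert 1 A" using subrng_power[OF assms(2,3), of n] by (cases n) auto
  qed
  then have "finite (range (\<lambda>n. a ^ n))" using assms(1) finite_subset by blast
  from eventually_periodic_idempotent[OF this] show ?thesis by (simp add: power_add)
qed

lemma binomial_commuting:
  fixes a b :: "'a::ring_1"
  assumes "a * b = b * a"
  shows "(a + b) ^ n = (\<Sum>k\<le>n. of_nat (n choose k) * a ^ k * b ^ (n - k))"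
proof (induction n)
  case (Suc n)
  have comm: "b * a ^ k = a ^ k * b" for k using power_commute_left[OF assms] by simp
  have ofn: "x * (of_nat m * y) = of_nat m * (x * y)" for x y :: 'a and m
    by (metis mult.assoc mult_of_nat_commute)
  have "(a + b) ^ Suc n = a * (\<Sum>k\<le>n. of_nat (n choose k) * a ^ k * b ^ (n - k))
      + b * (\<Sum>k\<le>n. of_nat (n choose k) * a ^ k * b ^ (n - k))"
    by (simp add: Suc algebra_simps)
  also have "a * (\<Sum>k\<le>n. of_nat (n choose k) * a ^ k * b ^ (n - k))
      = (\<Sum>k\<le>n. of_nat (n choose k) * a ^ Suc k * b ^ (n - k))"
    by (simp add: sum_distrib_left mult.assoc ofn)
  also have "\<dots> = (\<Sum>k\<in>{1..Suc n}. of_nat (n choose (k - 1)) * a ^ k * b ^ (Suc n - k))"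
    by (rule sum.reindex_bij_witness[of _ "\<lambda>k. k - 1" Suc]) auto
  also have "\<dots> = (\<Sum>k\<le>Suc n. (if k = 0 then 0 else of_nat (n choose (k - 1))) * a ^ k * b ^ (Suc n - k))"
    by (rule sum.mono_neutral_cong_left) auto
  also have "b * (\<Sum>k\<le>n. of_nat (n choose k) * a ^ k * b ^ (n - k))
      = (\<Sum>k\<le>n. of_nat (n choose k) * a ^ k * b ^ (Suc n - k))"
  proof -
    have "b * (of_nat m * (a ^ k * b ^ l)) = of_nat m * (a ^ k * b ^ Suc l)" for m k l
      by (metis comm mult.assoc ofn power_Suc)
    then show ?thesis
      by (auto simp: sum_distrib_left mult.assoc Suc_diff_le intro!: sum.cong)
  qed
  also have "\<dots> = (\<Sum>k\<le>Suc n. of_nat (n choose k) * a ^ k * b ^ (Suc n - k))"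
    by (simp add: binomial_eq_0)
  finally have "(a + b) ^ Suc n = (\<Sum>k\<le>Suc n. ((if k = 0 then 0 else of_nat (n choose (k - 1)))
      + of_nat (n choose k)) * a ^ k * b ^ (Suc n - k))"
    by (simp only: sum.distrib[symmetric] distrib_right)
  also have "\<dots> = (\<Sum>k\<le>Suc n. of_nat (Suc n choose k) * a ^ k * b ^ (Suc n - k))"
    by (intro sum.cong refl) (auto simp: gr0_conv_Suc)
  finally show ?case .
qed simp

lemma frobenius_add_commuting:
  fixes a b :: "'a::ring_1"
  assumes "Factorial_Ring.prime p" "of_nat p = (0 :: 'a)" "a * b = b * a"
  shows "(a + b) ^ p = a ^ p + b ^ p"
proof -
  have p: "p > 0" using assms(1) prime_gt_0_nat by blast
  have "of_nat (p choose k) = (0 :: 'a)" if "0 < k" "k < p" for k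
  proof -
    have "p dvd (p choose k)" using assms(1) that by (intro dvd_choose_prime) auto
    then show ?thesis using assms(2) by (auto elim!: dvdE)
  qed
  then have "(\<Sum>k\<le>p. of_nat (p choose k) * a ^ k * b ^ (p - k))
      = (\<Sum>k\<in>{0, p}. of_nat (p choose k) * a ^ k * b ^ (p - k))"
    by (intro sum.mono_neutral_right) auto
  with p show ?thesis by (simp add: binomial_commuting[OF assms(3)] add.commute)
qed

lemma frobenius_power_add_commuting:
  fixes a b :: "'a::ring_1"
  assumes "Factorial_Ring.prime p" "of_nat p = (0 :: 'a)" "a * b = b * a"
  shows "(a + b) ^ (p ^ m) = a ^ (p ^ m) + b ^ (p ^ m)"
  using assms(3)
proof (induction m)
  case (Suc m)
  have "a ^ (p ^ m) * b ^ (p ^ m) = b ^ (p ^ m) * a ^ (p ^ m)"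
    using power_commute_left[OF power_commute_left[OF Suc.prems, symmetric]] by metis
  then show ?case
    using Suc frobenius_add_commuting[OF assms(1,2)]
    by (simp add: power_mult mult.commute[of p])
qed simp

section \<open>Finite rings with central nilpotents and idempotents\<close>

text \<open>
  Here \<open>q\<close> is a power of the characteristic, and \<open>a\<^sup>q\<close> is the semisimple part of \<open>a\<close>, so that the
  noncommutativity of \<open>A\<close> is visible on the elements with \<open>s\<^sup>q = s\<close>. The identity \<open>e\<close> of \<open>A\<close> may
  differ from \<open>1\<close>, so \<open>a\<^sup>0\<close> need not lie in \<open>A\<close>.
\<close>

locale centralizer_commutative_ring =
  fixes A :: "'a::ring_1 set" and e :: 'a and q :: nat
  assumes finite_A: "finite A" and subrng_A: "subrng A"
    and e_in: "e \<in> A" and e_left: "\<And>a. a \<in> A \<Longrightarrow> e * a = a" and e_right: "\<And>a. a \<in> A \<Longrightarrow> a * e = a"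
    and unit_or_nilpotent: "\<And>a. a \<in> A \<Longrightarrow> (\<exists>k. a ^ k = 0) \<or> (\<exists>n>0. a ^ n = e)"
    and nilpotent_central: "\<And>a b k. a \<in> A \<Longrightarrow> a ^ k = 0 \<Longrightarrow> b \<in> A \<Longrightarrow> a * b = b * a"
    and q_gt_1: "q > 1"
    and frob_idem: "\<And>a. a \<in> A \<Longrightarrow> (a ^ q) ^ q = a ^ q"
    and frob_add: "\<And>a b. a \<in> A \<Longrightarrow> b \<in> A \<Longrightarrow> a * b = b * a \<Longrightarrow> (a + b) ^ q = a ^ q + b ^ q"
    and centralizer_commute: "\<And>a b c x. a \<in> A \<Longrightarrow> x \<in> A \<Longrightarrow> a * x \<noteq> x * a \<Longrightarrow> b \<in> A \<Longrightarrow> c \<in> A \<Longrightarrow>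
      a * b = b * a \<Longrightarrow> a * c = c * a \<Longrightarrow> b * c = c * b"
begin

lemmas A_closed [simp, intro] = subrng_0[OF subrng_A] subrng_diff[OF subrng_A] subrng_mult[OF subrng_A]
  subrng_uminus[OF subrng_A] subrng_add[OF subrng_A]

lemma A_power: "a \<in> A \<Longrightarrow> n > 0 \<Longrightarrow> a ^ n \<in> A"
  by (rule subrng_power[OF subrng_A])

lemma e_power: "n > 0 \<Longrightarrow> e ^ n = e"
proof (induction n)
  case (Suc n)
  then show ?case using e_left[OF e_in] by (cases n) auto
qed simp

lemma frob_diff:
  assumes "a \<in> A" "b \<in> A" "a * b = b * a"
  shows "(a - b) ^ q = a ^ q - b ^ q"
proof -
  have "(a - b) * b = b * (a - b)" using assms(3) by (simp add: algebra_simps)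
  then have "((a - b) + b) ^ q = (a - b) ^ q + b ^ q" using assms(1,2) by (intro frob_add) auto
  then show ?thesis by (simp add: algebra_simps)
qed

text \<open>The \<open>q\<close>-th power of the difference is
  \<open>a ^ q - (a ^ q) ^ q = 0\<close>, so nilpotency gives centrality. Hence \<open>a\<close> and
  \<open>a ^ q\<close> commute with the same elements of \<open>A\<close>, and a noncentral element
  may be replaced by one fixed under the \<open>q\<close>-th power.\<close>

lemma diff_frob_central:
  assumes "a \<in> A" "b \<in> A"
  shows "(a - a ^ q) * b = b * (a - a ^ q)"
proof (rule nilpotent_central)
  have aq: "a ^ q \<in> A" using assms(1) q_gt_1 by (intro A_power) auto
  have "(a - a ^ q) ^ q = a ^ q - (a ^ q) ^ q"
    using assms(1) aq by (intro frob_diff) (auto simp: power_commutes)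
  then show "(a - a ^ q) ^ q = 0" using frob_idem[OF assms(1)] by simp
  show "a - a ^ q \<in> A" using assms(1) aq by auto
qed fact

lemma frob_commute_iff:
  assumes "a \<in> A" "b \<in> A"
  shows "a ^ q * b = b * a ^ q \<longleftrightarrow> a * b = b * a"
  using diff_frob_central[OF assms] by (auto simp: algebra_simps)

lemma noncentral_unit:
  assumes "a \<in> A" "b \<in> A" "a * b \<noteq> b * a"
  obtains a' n where "a' \<in> A" "a * a' = e" "a' * a = e" "n > 0" "a ^ n = e"
proof -
  obtain n where n: "n > 0" "a ^ n = e"
    using unit_or_nilpotent[OF assms(1)] nilpotent_central[OF assms(1) _ assms(2)] assms(3) by blast
  \<comment> \<open>The exponent is \<open>2 n\<close>: unlike \<open>n - 1\<close>, the number
    \<open>n + n - 1\<close> is positive even for \<open>n = 1\<close>, so the inverse lies in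
    \<open>A\<close>.\<close>
  have "a ^ Suc (n + n - 1) = e"
    using n e_left[OF e_in] by (simp add: power_add)
  then have "a * a ^ (n + n - 1) = e" "a ^ (n + n - 1) * a = e"
    by (simp_all add: power_commutes)
  moreover have "a ^ (n + n - 1) \<in> A" using assms(1) n(1) by (intro A_power) auto
  ultimately show ?thesis using that n by blast
qed

lemma noncommuting_frob_fixed:
  assumes "\<not> commutative_on A"
  obtains s y where "s \<in> A" "y \<in> A" "s ^ q = s" "s * y \<noteq> y * s"
proof -
  obtain a b where ab: "a \<in> A" "b \<in> A" "a * b \<noteq> b * a"
    using assms by (auto simp: commutative_on_def)
  show ?thesis
    by (rule that[of "a ^ q" b])
       (use ab q_gt_1 in \<open>auto simp: frob_idem frob_commute_iff intro: A_power\<close>)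
qed

end

section \<open>A finite field in the centralizer of a noncentral element\<close>

locale centralizer_field = centralizer_commutative_ring A e q
  for A :: "'a::ring_1 set" and e q +
  fixes s y :: 'a
  assumes s_in: "s \<in> A" and y_in: "y \<in> A" and s_fixed: "s ^ q = s" and s_y: "s * y \<noteq> y * s"
begin

text \<open>The semisimple part of the centralizer of \<open>s\<close>. Its elements commute because
  that centralizer is commutative, and \<open>t ^ q = t\<close> excludes nonzero nilpotents, so
  \<open>E\<close> is a finite field with identity \<open>e\<close>.\<close>

definition E :: "'a set" where
  "E = {t \<in> A. s * t = t * s \<and> t ^ q = t}"

definition Eu :: "'a set" where
  "Eu = E - {0}"

lemma E_A: "t \<in> E \<Longrightarrow> t \<in> A"
  by (simp add: E_def)

lemma E_commute: "t \<in> E \<Longrightarrow> u \<in> E \<Longrightarrow> t * u = u * t"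
  using centralizer_commute[OF s_in y_in s_y] by (auto simp: E_def)

lemma finite_E: "finite E" "finite Eu"
  using finite_A by (auto simp: E_def Eu_def)

lemma s_E: "s \<in> E"
  using s_in s_fixed by (simp add: E_def)

lemma e_E: "e \<in> E"
  using e_in q_gt_1 s_in by (simp add: E_def e_power e_left e_right)

lemma e_neq_0: "e \<noteq> 0"
  using e_left[OF s_in] e_left[OF y_in] s_y by auto

lemma subrng_E: "subrng E"
  unfolding subrng_def
proof (intro conjI ballI)
  show "0 \<in> E" using q_gt_1 by (simp add: E_def zero_power)
  fix a b assume ab: "a \<in> E" "b \<in> E"
  note c = E_commute[OF ab]
  have "(a - b) ^ q = a - b" using frob_diff[of a b] ab c by (auto simp: E_def)
  then show "a - b \<in> E" using ab by (auto simp: E_def algebra_simps)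
  have "(a * b) ^ q = a * b" using ab by (simp add: power_mult_distrib_commuting[OF c] E_def)
  moreover have "s * (a * b) = a * b * s"
  proof -
    have "s * a = a * s" "s * b = b * s" using ab by (auto simp: E_def)
    then show ?thesis by (metis mult.assoc)
  qed
  ultimately show "a * b \<in> E" using ab by (auto simp: E_def)
qed

lemmas E_closed = subrng_0[OF subrng_E] subrng_diff[OF subrng_E] subrng_mult[OF subrng_E]
  subrng_uminus[OF subrng_E] subrng_add[OF subrng_E]

lemma Eu_E: "t \<in> Eu \<Longrightarrow> t \<in> E"
  by (simp add: Eu_def)

lemma e_Eu: "e \<in> Eu"
  using e_E e_neq_0 by (simp add: Eu_def)

lemma s_Eu: "s \<in> Eu"
  using s_E s_y by (auto simp: Eu_def)

lemma E_frob_iterate: "t \<in> E \<Longrightarrow> t ^ (q ^ j) = t"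
  by (induction j) (auto simp: power_mult E_def)

lemma Eu_finite_order:
  assumes "t \<in> Eu"
  shows "\<exists>n>0. t ^ n = e"
proof -
  have False if "t ^ k = 0" for k
  proof -
    \<comment> \<open>A vanishing \<open>t ^ k\<close> is a factor of \<open>t ^ (q ^ k) = t\<close>
      and would make \<open>t\<close> zero.\<close>
    have "k < q ^ k" using q_gt_1 by (intro power_gt_expt) auto
    then have "t ^ (q ^ k) = t ^ k * t ^ (q ^ k - k)" by (simp flip: power_add)
    then show False using that E_frob_iterate[of t k] assms by (simp add: Eu_def)
  qed
  then show ?thesis using unit_or_nilpotent[of t] assms by (auto simp: Eu_def E_def)
qed

lemma Eu_inverse:
  assumes "t \<in> Eu"
  obtains t' where "t' \<in> Eu" "t * t' = e" "t' * t = e"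
proof -
  obtain n where n: "n > 0" "t ^ n = e" using Eu_finite_order[OF assms] by blast
  define t' where "t' = t ^ (n + n - 1)"
  have "t ^ Suc (n + n - 1) = e"
    using n e_left[OF e_in] by (simp add: power_add)
  then have *: "t * t' = e" "t' * t = e"
    by (simp_all add: t'_def power_commutes)
  moreover have "t' \<in> E" unfolding t'_def using assms n(1) subrng_power[OF subrng_E] by (auto simp: Eu_def)
  moreover have "t' \<noteq> 0" using * e_neq_0 by auto
  ultimately show ?thesis using that by (auto simp: Eu_def)
qed

lemma Eu_cancel_left:
  assumes "t \<in> Eu" "a \<in> A" "b \<in> A" "t * a = t * b"
  shows "a = b"
proof -
  obtain t' where "t' \<in> Eu" "t' * t = e" using Eu_inverse[OF assms(1)] by blast
  then have "e * a = e * b" using assms(4) by (metis mult.assoc)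
  then show ?thesis using assms by (simp add: e_left)
qed

lemma Eu_mult:
  assumes "t \<in> Eu" "u \<in> Eu"
  shows "t * u \<in> Eu"
proof -
  have "t * u \<noteq> t * 0"
    using Eu_cancel_left[OF assms(1), of u 0] assms by (auto simp: Eu_def E_A)
  then show ?thesis using assms E_closed by (auto simp: Eu_def)
qed

lemma Eu_mult_bij:
  assumes "t \<in> Eu"
  shows "bij_betw (\<lambda>u. t * u) Eu Eu"
proof -
  have "inj_on (\<lambda>u. t * u) Eu"
    by (rule inj_onI) (use Eu_cancel_left[OF assms] in \<open>auto simp: Eu_E E_A\<close>)
  moreover have "(\<lambda>u. t * u) ` Eu \<subseteq> Eu" using Eu_mult[OF assms] by auto
  ultimately show ?thesis
    using endo_inj_surj[OF finite_E(2)] unfolding bij_betw_def by blast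
qed

lemma E_sum: "(\<And>i. i \<in> I \<Longrightarrow> f i \<in> E) \<Longrightarrow> sum f I \<in> E"
  by (rule subrng_sum[OF subrng_E])

text \<open>The additive translation by \<open>e\<close> shows \<open>|E| e = 0\<close>.\<close>

lemma sum_Eu_e: "(\<Sum>\<mu>\<in>Eu. e) = - e"
proof -
  have "bij_betw (\<lambda>u. u + e) E E"
    by (rule bij_betw_byWitness[of _ "\<lambda>u. u - e"]) (use e_E E_closed in auto)
  then have "(\<Sum>u\<in>E. u + e) = (\<Sum>u\<in>E. u)" by (rule sum.reindex_bij_betw)
  then have "(\<Sum>u\<in>E. e) = 0" by (simp add: sum.distrib)
  moreover have "(\<Sum>u\<in>E. e) = e + (\<Sum>u\<in>Eu. e)"
    unfolding Eu_def using sum.remove[OF finite_E(1), of 0 "\<lambda>_. e"] E_closed(1) .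
  ultimately have "e + (\<Sum>u\<in>Eu. e) = 0" by (simp only:)
  then show ?thesis by (metis minus_unique)
qed

text \<open>The exponent of the finite abelian group \<open>Eu\<close>. Minimality supplies, for
  each \<open>0 < j < expo\<close>, an element whose \<open>j\<close>-th power is not
  \<open>e\<close>.\<close>

definition expo :: nat where
  "expo = (LEAST n. n > 0 \<and> (\<forall>\<mu>\<in>Eu. \<mu> ^ n = e))"

lemma expo: "expo > 0" "\<And>\<mu>. \<mu> \<in> Eu \<Longrightarrow> \<mu> ^ expo = e"
proof -
  obtain n where n: "\<And>\<mu>. \<mu> \<in> Eu \<Longrightarrow> n \<mu> > (0::nat) \<and> \<mu> ^ n \<mu> = e"
    using Eu_finite_order by metis
  define N where "N = (\<Prod>\<mu>\<in>Eu. n \<mu>)"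
  have N: "N > 0" using n by (auto simp: N_def intro: prod_pos)
  have "\<mu> ^ N = e" if "\<mu> \<in> Eu" for \<mu>
  proof -
    have "n \<mu> dvd N" unfolding N_def using finite_E(2) that by (rule dvd_prodI)
    then obtain k where k: "N = n \<mu> * k" by (auto elim: dvdE)
    with N have "k > 0" by (cases k) auto
    then show ?thesis using n[OF that] by (simp add: k power_mult e_power)
  qed
  with N have "\<exists>n. n > 0 \<and> (\<forall>\<mu>\<in>Eu. \<mu> ^ n = e)" by blast
  from LeastI_ex[OF this] show "expo > 0" "\<And>\<mu>. \<mu> \<in> Eu \<Longrightarrow> \<mu> ^ expo = e"
    by (auto simp: expo_def)
qed

text \<open>Multiplying the summation index by some \<open>\<nu>\<close> with
  \<open>\<nu> ^ j \<noteq> e\<close> permutes \<open>Eu\<close> and multiplies the sum by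
  \<open>\<nu> ^ j\<close>; the nonzero factor \<open>\<nu> ^ j - e\<close> then cancels.\<close>

lemma power_sum_0:
  assumes "0 < j" "j < expo"
  shows "(\<Sum>\<mu>\<in>Eu. \<mu> ^ j) = 0"
proof -
  obtain \<nu> where \<nu>: "\<nu> \<in> Eu" "\<nu> ^ j \<noteq> e"
    using not_less_Least[OF assms(2)[unfolded expo_def]] assms(1) by auto
  let ?S = "\<Sum>\<mu>\<in>Eu. \<mu> ^ j"
  have p: "\<mu> ^ j \<in> E" if "\<mu> \<in> Eu" for \<mu> using subrng_power[OF subrng_E] that assms by (auto simp: Eu_def)
  then have S: "?S \<in> E" by (rule E_sum)
  have "?S = (\<Sum>\<mu>\<in>Eu. (\<nu> * \<mu>) ^ j)"
    by (rule sum.reindex_bij_betw[OF Eu_mult_bij[OF \<nu>(1)], symmetric])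
  also have "\<dots> = \<nu> ^ j * ?S"
    unfolding sum_distrib_left
    by (intro sum.cong refl power_mult_distrib_commuting E_commute) (use \<nu> in \<open>auto simp: Eu_def\<close>)
  finally have "(\<nu> ^ j - e) * ?S = (\<nu> ^ j - e) * 0"
    using e_left[OF E_A[OF S]] by (simp add: algebra_simps)
  moreover have "\<nu> ^ j - e \<in> Eu" using \<nu> p e_E E_closed by (auto simp: Eu_def)
  ultimately show ?thesis using Eu_cancel_left S E_A A_closed(1) by blast
qed

text \<open>Skolem--Noether in disguise: the sums \<open>\<Sum>i. s\<^sup>i y \<mu>\<^sup>i\<close> are the projections of \<open>y\<close> to the
  simultaneous eigenspaces of left and right multiplication by \<open>s\<close>.\<close>

lemma exists_intertwiner:
  obtains r \<nu> where "r \<in> A" "\<nu> \<in> E" "s * r = r * \<nu>" "s * r \<noteq> r * s"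
proof -
  define R where "R = (\<lambda>\<mu>. \<Sum>i<expo. s ^ i * y * \<mu> ^ i)"
  have RA: "R \<mu> \<in> A" if "\<mu> \<in> Eu" for \<mu>
  proof -
    have "s ^ i * y * \<mu> ^ i \<in> A" for i
      using subrng_mult_power[OF subrng_A] y_in s_in that by (metis Eu_E E_A)
    then show ?thesis unfolding R_def by (intro subrng_sum[OF subrng_A]) auto
  qed
  \<comment> \<open>The outer factors raise every exponent by one, and the sum closes up cyclically
    since \<open>s ^ expo = e = \<mu> ^ expo\<close>.\<close>
  have shift: "s * R \<mu> * \<mu> = R \<mu>" if \<mu>: "\<mu> \<in> Eu" for \<mu>
  proof -
    define g where "g = (\<lambda>i. s ^ i * y * \<mu> ^ i)"
    have "s * R \<mu> * \<mu> = (\<Sum>i<expo. g (Suc i))"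
      by (simp add: R_def g_def sum_distrib_left sum_distrib_right mult.assoc power_commutes)
    also have "\<dots> = (\<Sum>i<expo. g i) + g expo - g 0"
      by (metis add_diff_cancel_left' lessThan_Suc_atMost sum.lessThan_Suc sum.lessThan_Suc_shift)
    also have "g expo = g 0" using expo(2)[OF s_Eu] expo(2)[OF \<mu>] y_in
      by (simp add: g_def e_left e_right)
    finally show ?thesis by (simp add: R_def g_def)
  qed
  \<comment> \<open>By \<open>power_sum_0\<close> only \<open>i = 0\<close> survives, and there the
    sum over \<open>Eu\<close> contributes \<open>- e\<close>. As \<open>y\<close> does not commute
    with \<open>s\<close>, some \<open>R \<mu>\<close> does not either.\<close>
  have "(\<Sum>\<mu>\<in>Eu. R \<mu>) = (\<Sum>i<expo. s ^ i * y * (\<Sum>\<mu>\<in>Eu. \<mu> ^ i))"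
    unfolding R_def by (subst sum.swap) (simp add: sum_distrib_left)
  also have "\<dots> = (\<Sum>i\<in>{0}. s ^ i * y * (\<Sum>\<mu>\<in>Eu. \<mu> ^ i))"
    using expo(1) power_sum_0 by (intro sum.mono_neutral_right) auto
  also have "\<dots> = y * e * (\<Sum>\<mu>\<in>Eu. 1)"
    using y_in by (simp add: e_right)
  also have "\<dots> = y * (\<Sum>\<mu>\<in>Eu. e)"
    by (simp only: mult.assoc sum_distrib_left mult_1_right)
  also have "\<dots> = - y" using y_in by (simp only: sum_Eu_e mult_minus_right e_right)
  finally have sumR: "(\<Sum>\<mu>\<in>Eu. R \<mu>) = - y" .
  have "\<exists>\<mu>\<in>Eu. s * R \<mu> \<noteq> R \<mu> * s"
  proof (rule ccontr)
    assume "\<not> ?thesis"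
    then have "s * (\<Sum>\<mu>\<in>Eu. R \<mu>) = (\<Sum>\<mu>\<in>Eu. R \<mu>) * s"
      by (simp add: sum_distrib_left sum_distrib_right)
    then show False using s_y by (simp add: sumR)
  qed
  then obtain \<mu> where \<mu>: "\<mu> \<in> Eu" "s * R \<mu> \<noteq> R \<mu> * s" by blast
  obtain \<nu> where \<nu>: "\<nu> \<in> Eu" "\<mu> * \<nu> = e" using Eu_inverse[OF \<mu>(1)] by blast
  have "s * R \<mu> = s * R \<mu> * \<mu> * \<nu>"
    using RA[OF \<mu>(1)] s_in by (simp add: mult.assoc \<nu> e_right)
  also have "\<dots> = R \<mu> * \<nu>" using shift[OF \<mu>(1)] by simp
  finally show ?thesis using that RA[OF \<mu>(1)] \<mu> \<nu> Eu_E by blast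
qed

end

text \<open>The intertwining relation reads \<open>s = r * \<nu> * r'\<close> with
  \<open>\<nu>\<close> in the commutative \<open>E\<close>, so every \<open>r * t * r'\<close>
  commutes with \<open>s\<close> again. Passing to the \<open>q\<close>-th power of the intertwiner
  makes it fixed under the \<open>q\<close>-th power without changing what commutes with it.\<close>

lemma (in centralizer_field) exists_normalizing_unit:
  obtains r r' where "r \<in> A" "r' \<in> A" "r * r' = e" "r' * r = e" "r ^ q = r"
    "\<And>t. t \<in> E \<Longrightarrow> r * t * r' \<in> E" "r * s \<noteq> s * r"
proof -
  obtain r \<nu> where r: "r \<in> A" "\<nu> \<in> E" "s * r = r * \<nu>" "s * r \<noteq> r * s"
    using exists_intertwiner by blast
  then obtain r' where r': "r' \<in> A" "r * r' = e" "r' * r = e"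
    using noncentral_unit[OF r(1) s_in] by metis
  have red: "r' * (r * x) = e * x" for x by (simp add: r' flip: mult.assoc)
  have s: "s = r * \<nu> * r'" using r(3) r' s_in by (metis e_right mult.assoc)
  have conj: "r * t * r' \<in> E" if t: "t \<in> E" for t
  proof -
    let ?u = "r * t * r'"
    have uA: "?u \<in> A" using r(1) r'(1) E_A[OF t] by auto
    have "s * ?u = r * \<nu> * r' * (r * t * r')" by (simp only: s[symmetric])
    also have "\<dots> = r * (\<nu> * t) * r'"
      using r' E_A[OF t] by (simp add: mult.assoc red e_left)
    also have "\<dots> = r * (t * \<nu>) * r'" by (simp only: E_commute[OF r(2) t])
    also have "\<dots> = ?u * s"
    proof -
      have "?u * (r * \<nu> * r') = r * (t * \<nu>) * r'"
        using r' E_A[OF r(2)] by (simp add: mult.assoc red e_left)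
      then show ?thesis by (simp only: s[symmetric])
    qed
    finally have c: "s * ?u = ?u * s" .
    have "?u ^ n = r * t ^ n * r'" if "n > 0" for n
      using that
    proof (induction n)
      case (Suc n)
      show ?case
      proof (cases "n = 0")
        case False
        then have "?u ^ Suc n = r * t * (r' * (r * (t ^ n * r')))"
          using Suc by (simp add: mult.assoc)
        also have "\<dots> = r * t ^ Suc n * r'"
          using False r'(1) A_power[OF E_A[OF t], of n] by (simp add: red e_left mult.assoc)
        finally show ?thesis .
      qed simp
    qed simp
    from this[of q] have "?u ^ q = ?u" using q_gt_1 t by (simp add: E_def)
    with uA c show ?thesis by (simp add: E_def)
  qed
  have conj_power: "r ^ n * t * r' ^ n \<in> E" if "t \<in> E" for t n
  proof (induction n)
    case (Suc n)
    have "r ^ Suc n * t * r' ^ Suc n = r * (r ^ n * t * r' ^ n) * r'"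
      by (metis mult.assoc power_Suc power_Suc2)
    then show ?case using conj[OF Suc] by simp
  qed (use that in simp)
  have comm: "r * r' = r' * r" using r' by simp
  show ?thesis
  proof (rule that[of "r ^ q" "r' ^ q"])
    show "r ^ q \<in> A" "r' ^ q \<in> A" using r r' q_gt_1 by (auto intro: A_power)
    show "r ^ q * r' ^ q = e" "r' ^ q * r ^ q = e"
      using power_mult_distrib_commuting[OF comm, of q]
        power_mult_distrib_commuting[OF comm[symmetric], of q] e_power[of q] q_gt_1
      unfolding r'(2,3) by auto
    show "(r ^ q) ^ q = r ^ q" using frob_idem r by blast
    show "r ^ q * t * r' ^ q \<in> E" if "t \<in> E" for t using conj_power that by blast
    show "r ^ q * s \<noteq> s * r ^ q" using frob_commute_iff[OF r(1) s_in] r(4) by auto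
  qed
qed

section \<open>A field with an inner automorphism: independence, Hilbert 90 and norms\<close>

locale normalized_field = centralizer_field A e q s y
  for A :: "'a::ring_1 set" and e q s y +
  fixes r r' :: 'a
  assumes r_in: "r \<in> A" and r'_in: "r' \<in> A" and r_inv: "r * r' = e" "r' * r = e"
    and r_fixed: "r ^ q = r" and r_normal: "\<And>t. t \<in> E \<Longrightarrow> r * t * r' \<in> E"
    and r_s: "r * s \<noteq> s * r"
begin

definition \<sigma> :: "'a \<Rightarrow> 'a" where
  "\<sigma> t = r * t * r'"

lemma sigma_E: "t \<in> E \<Longrightarrow> \<sigma> t \<in> E"
  using r_normal by (simp add: \<sigma>_def)

lemma sigma_iter_E: "t \<in> E \<Longrightarrow> (\<sigma> ^^ i) t \<in> E"
  by (induction i) (auto intro: sigma_E)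

lemma r_sigma:
  assumes "t \<in> A"
  shows "r * t = \<sigma> t * r"
proof -
  have "\<sigma> t * r = r * t * (r' * r)" by (simp only: \<sigma>_def mult.assoc)
  also have "\<dots> = r * t" using assms r_in by (simp add: r_inv e_right)
  finally show ?thesis by simp
qed

lemma sigma_mult:
  assumes "t \<in> A" "u \<in> A"
  shows "\<sigma> (t * u) = \<sigma> t * \<sigma> u"
proof -
  have "\<sigma> t * \<sigma> u = \<sigma> t * r * u * r'" by (simp only: \<sigma>_def mult.assoc)
  also have "\<dots> = r * t * u * r'" by (simp only: r_sigma[OF assms(1)])
  finally show ?thesis by (simp add: \<sigma>_def mult.assoc)
qed

lemma r_cancel_right: "a \<in> A \<Longrightarrow> b \<in> A \<Longrightarrow> a * r = b * r \<Longrightarrow> a = b"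
  by (metis e_right mult.assoc r_inv(1))

lemma r_cancel_left: "a \<in> A \<Longrightarrow> b \<in> A \<Longrightarrow> r * a = r * b \<Longrightarrow> a = b"
  by (metis e_left mult.assoc r_inv(2))

lemma r_power_sigma:
  assumes "t \<in> E"
  shows "r ^ i * t = (\<sigma> ^^ i) t * r ^ i"
proof (induction i)
  case (Suc i)
  have "r ^ Suc i * t = r * (\<sigma> ^^ i) t * r ^ i" by (simp add: Suc mult.assoc)
  also have "\<dots> = (\<sigma> ^^ Suc i) t * r ^ Suc i"
    using r_sigma[OF E_A[OF sigma_iter_E[OF assms]]] by (simp add: mult.assoc)
  finally show ?case .
qed simp

text \<open>The order of the automorphism \<open>\<sigma>\<close> of \<open>E\<close>, read off from
  \<open>s\<close> alone: \<open>r ^ d\<close> commutes with \<open>s\<close> and hence lies in the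
  commutative \<open>E\<close>, while smaller positive powers of \<open>r\<close> move
  \<open>s\<close>.\<close>

definition d :: nat where
  "d = (LEAST n. n > 0 \<and> r ^ n * s = s * r ^ n)"

lemma d: "d > 0" "r ^ d * s = s * r ^ d" "\<And>n. 0 < n \<Longrightarrow> n < d \<Longrightarrow> r ^ n * s \<noteq> s * r ^ n"
proof -
  obtain n where "n > 0" "r ^ n = e"
    using noncentral_unit[OF r_in s_in r_s] by metis
  then have "\<exists>n. n > 0 \<and> r ^ n * s = s * r ^ n" using e_left e_right s_in by (intro exI[of _ n]) auto
  from LeastI_ex[OF this] show "d > 0" "r ^ d * s = s * r ^ d" by (auto simp: d_def)
  show "r ^ n * s \<noteq> s * r ^ n" if "0 < n" "n < d" for n
    using not_less_Least[OF that(2)[unfolded d_def]] that(1) by auto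
qed

lemma r_d_E: "r ^ d \<in> E"
proof -
  have "(r ^ d) ^ q = r ^ d" by (metis power_mult mult.commute r_fixed)
  then show ?thesis using d A_power[OF r_in, of d] by (simp add: E_def)
qed

lemma sigma_iter_inj:
  assumes "t \<in> E" "u \<in> E" "(\<sigma> ^^ i) t = (\<sigma> ^^ i) u"
  shows "t = u"
  using assms
proof (induction i arbitrary: t u)
  case (Suc i)
  have "\<sigma> t = \<sigma> u"
    using Suc.IH[of "\<sigma> t" "\<sigma> u"] Suc.prems by (simp add: sigma_E funpow_swap1)
  then have "r * t = r * u" using r_sigma E_A Suc.prems by metis
  then show ?case using r_cancel_left E_A Suc.prems by blast
qed simp

lemma sigma_iter_s_distinct:
  assumes "i < j" "j < d"
  shows "(\<sigma> ^^ i) s \<noteq> (\<sigma> ^^ j) s"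
proof
  assume *: "(\<sigma> ^^ i) s = (\<sigma> ^^ j) s"
  have "(\<sigma> ^^ j) s = (\<sigma> ^^ i) ((\<sigma> ^^ (j - i)) s)"
    using assms by (simp flip: funpow_add comp_apply[of "\<sigma> ^^ i"])
  then have "s = (\<sigma> ^^ (j - i)) s"
    using * sigma_iter_inj[OF s_E sigma_iter_E[OF s_E]] by metis
  then have "r ^ (j - i) * s = s * r ^ (j - i)" using r_power_sigma[OF s_E] by metis
  then show False using d(3)[of "j - i"] assms by auto
qed

text \<open>Dedekind's argument for the iterates of \<open>\<sigma>\<close>, with coefficients in
  the noncommutative \<open>A\<close>: they stand on the right, and only elements of the field are
  cancelled, on the left. The iterates are told apart by their values at \<open>s\<close>.\<close>

lemma dedekind_independence:
  assumes "0 < m" "m \<le> d" "\<And>i. i < m \<Longrightarrow> \<gamma> i \<in> A"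
    and "\<And>u. u \<in> E \<Longrightarrow> (\<Sum>i<m. (\<sigma> ^^ i) u * \<gamma> i) = 0"
  shows "\<gamma> 0 = 0"
  using assms
proof (induction m arbitrary: \<gamma>)
  case (Suc m)
  show ?case
  proof (cases "m = 0")
    case True
    then show ?thesis using Suc.prems(4)[OF e_E] Suc.prems(3)[of 0] by (simp add: e_left)
  next
    case False
    define x where "x = (\<lambda>i. (\<sigma> ^^ i) s)"
    have xE: "x i \<in> E" for i by (simp add: x_def sigma_iter_E s_E)
    have "(x 0 - x m) * \<gamma> 0 = 0"
    proof (rule Suc.IH)
      show "0 < m" "m \<le> d" using False Suc.prems by auto
      show "(x i - x m) * \<gamma> i \<in> A" if "i < m" for i
        using that Suc.prems(3)[of i] xE E_A by auto
      fix u assume u: "u \<in> E"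
      have iter: "(\<sigma> ^^ i) (u * s) = (\<sigma> ^^ i) u * x i" for i
        using u s_E by (induction i) (auto simp: x_def sigma_mult E_A sigma_iter_E)
      have c: "x m * (\<sigma> ^^ i) u = (\<sigma> ^^ i) u * x m" for i
        using E_commute xE sigma_iter_E u by blast
      \<comment> \<open>Subtracting \<open>x m\<close> times the relation at \<open>u\<close> from
        the relation at \<open>u * s\<close> kills the term with index \<open>m\<close> and
        multiplies \<open>\<gamma> 0\<close> by the nonzero \<open>x 0 - x m\<close>.\<close>
      have "(\<Sum>i<Suc m. (\<sigma> ^^ i) u * ((x i - x m) * \<gamma> i))
          = (\<Sum>i<Suc m. (\<sigma> ^^ i) (u * s) * \<gamma> i) - x m * (\<Sum>i<Suc m. (\<sigma> ^^ i) u * \<gamma> i)"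
        unfolding sum_distrib_left sum_subtractf[symmetric] iter
        by (intro sum.cong refl) (simp add: algebra_simps c flip: mult.assoc)
      also have "\<dots> = 0"
        using Suc.prems(4)[OF u] Suc.prems(4)[OF E_closed(3)[OF u s_E]] by simp
      finally show "(\<Sum>i<m. (\<sigma> ^^ i) u * ((x i - x m) * \<gamma> i)) = 0" by simp
    qed
    moreover have "x 0 - x m \<in> Eu"
      using sigma_iter_s_distinct[of 0 m] False Suc.prems(2) E_closed(2)[OF xE[of 0] xE[of m]]
      by (auto simp: Eu_def x_def)
    ultimately show ?thesis
      using Eu_cancel_left[of "x 0 - x m" "\<gamma> 0" 0] Suc.prems(3)[of 0] by auto
  qed
qed simp

text \<open>Hilbert's Theorem 90: the sums \<open>\<Sum>i. w\<^sup>i u w'\<^sup>-\<^sup>i\<close> conjugate \<open>w'\<close> into \<open>w\<close>.\<close>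

lemma hilbert90:
  assumes w: "w \<in> A" "\<And>u. u \<in> E \<Longrightarrow> w * u = \<sigma> u * w"
    and w': "w' \<in> A" "v' \<in> A" "w' * v' = e" "v' * w' = e"
    and eq: "w ^ d = w' ^ d" and central: "\<And>u. u \<in> E \<Longrightarrow> w ^ d * u = u * w ^ d"
  obtains u where "u \<in> E" "(\<Sum>i<d. w ^ i * u * v' ^ i) \<noteq> 0"
    "w * (\<Sum>i<d. w ^ i * u * v' ^ i) = (\<Sum>i<d. w ^ i * u * v' ^ i) * w'"
proof -
  define T where "T = (\<lambda>u. \<Sum>i<d. w ^ i * u * v' ^ i)"
  have TA: "T u \<in> A" if "u \<in> E" for u unfolding T_def
    using w(1) w'(2) E_A[OF that] by (intro subrng_sum subrng_mult_power subrng_A)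
  have wi: "w ^ i * u = (\<sigma> ^^ i) u * w ^ i" if "u \<in> E" for u i
  proof (induction i)
    case (Suc i)
    have "w ^ Suc i * u = w * (\<sigma> ^^ i) u * w ^ i" by (simp add: Suc mult.assoc)
    also have "\<dots> = (\<sigma> ^^ Suc i) u * w ^ Suc i"
      using w(2)[OF sigma_iter_E[OF that]] by (simp add: mult.assoc)
    finally show ?case .
  qed simp
  have "\<exists>u\<in>E. T u \<noteq> 0"
  proof (rule ccontr)
    assume *: "\<not> ?thesis"
    \<comment> \<open>If every \<open>T u\<close> vanished, independence with these coefficients
      would give \<open>e = 0\<close>. The factor \<open>e\<close> puts the coefficient at index 0
      into \<open>A\<close>.\<close>
    have "w ^ 0 * v' ^ 0 * e = 0"
    proof (rule dedekind_independence[OF d(1) order_refl, of "\<lambda>i. w ^ i * v' ^ i * e"])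
      show "w ^ i * v' ^ i * e \<in> A" for i
        unfolding mult.assoc
        by (intro subrng_mult_power(2)[OF subrng_A] w(1) w'(2) e_in)
      fix u assume u: "u \<in> E"
      have "(\<Sum>i<d. (\<sigma> ^^ i) u * (w ^ i * v' ^ i * e)) = T u * e"
        by (simp add: T_def sum_distrib_right flip: mult.assoc wi[OF u])
      then show "(\<Sum>i<d. (\<sigma> ^^ i) u * (w ^ i * v' ^ i * e)) = 0" using * u by auto
    qed
    then show False using e_neq_0 by simp
  qed
  then obtain u where u: "u \<in> E" "T u \<noteq> 0" by blast
  define g where "g = (\<lambda>i. w ^ i * u * v' ^ i)"
  \<comment> \<open>The outer factors shift the summands by one, and the sum closes up because
    \<open>w ^ d\<close> commutes with \<open>u\<close> and cancels against
    \<open>v' ^ d\<close>.\<close>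
  have "w * T u * v' = (\<Sum>i<d. g (Suc i))"
    by (simp add: T_def g_def sum_distrib_left sum_distrib_right mult.assoc power_commutes)
  also have "\<dots> = (\<Sum>i<d. g i) + g d - g 0"
    by (metis add_diff_cancel_left' lessThan_Suc_atMost sum.lessThan_Suc sum.lessThan_Suc_shift)
  also have "g d = g 0"
  proof -
    have "w' ^ d * v' ^ d = e"
      using power_mult_distrib_commuting[of w' v' d] w' e_power[OF d(1)] by simp
    moreover have "g d = u * w ^ d * v' ^ d" by (simp only: g_def central[OF u(1)])
    ultimately have "g d = u * e" by (simp add: eq mult.assoc)
    then show ?thesis using u E_A by (simp add: g_def e_right)
  qed
  finally have "w * T u * v' = T u" by (simp add: T_def g_def)
  then have "w * T u = T u * w'"
    using w'(4) w(1) TA[OF u(1)] by (metis A_closed(3) e_right mult.assoc)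
  with u that show ?thesis by (simp add: T_def)
qed

text \<open>Since \<open>c\<close> commutes with \<open>E\<close>, every element of
  \<open>E * r\<close> moves past \<open>E\<close> in the same way as \<open>r\<close>.\<close>

lemma coset_commute:
  assumes "c \<in> E" "u \<in> E"
  shows "c * r * u = \<sigma> u * (c * r)"
  using r_sigma[OF E_A[OF assms(2)]] E_commute[OF assms(1) sigma_E[OF assms(2)]]
  by (metis mult.assoc)

text \<open>At exponent \<open>d\<close> this puts the power into \<open>E\<close>, because
  \<open>r ^ d\<close> lies there. Exponent 0 is left out, as \<open>1\<close> need not be in
  \<open>E\<close>.\<close>

lemma coset_power: "c \<in> E \<Longrightarrow> \<exists>h\<in>E. (c * r) ^ Suc i = h * r ^ Suc i"
proof (induction i)
  case 0
  then show ?case by auto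
next
  case (Suc i)
  then obtain h where h: "h \<in> E" "(c * r) ^ Suc i = h * r ^ Suc i" by blast
  have "(c * r) ^ Suc (Suc i) = c * r * h * r ^ Suc i" by (simp only: power_Suc[of _ "Suc i"] h(2) mult.assoc)
  also have "\<dots> = c * \<sigma> h * r ^ Suc (Suc i)"
    by (metis (no_types) E_A h(1) mult.assoc power_Suc r_sigma)
  finally show ?case using Suc.prems h(1) E_closed(3) sigma_E by blast
qed

lemma coset_inverse:
  assumes "c \<in> Eu"
  obtains v where "v \<in> A" "c * r * v = e" "v * (c * r) = e"
    "\<And>t b. t \<in> E \<Longrightarrow> b \<in> E \<Longrightarrow> b * r * t * v \<in> E"
proof -
  obtain c' where c': "c' \<in> Eu" "c * c' = e" "c' * c = e" using Eu_inverse[OF assms] by blast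
  have in_A: "c \<in> A" "c' \<in> A" using assms c' Eu_E E_A by auto
  have bE: "b * r * t * (r' * c') \<in> E" if "t \<in> E" "b \<in> E" for t b
  proof -
    have "b * r * t * (r' * c') = b * \<sigma> t * c'" by (simp add: \<sigma>_def mult.assoc)
    then show ?thesis using that c' Eu_E E_closed(3) sigma_E by metis
  qed
  show ?thesis
  proof (rule that[of "r' * c'"])
    show "r' * c' \<in> A" using in_A r'_in by auto
    have "c * r * (r' * c') = c * (r * r') * c'" by (simp only: mult.assoc)
    then show "c * r * (r' * c') = e" using in_A c' by (simp add: r_inv e_right)
    have "r' * c' * (c * r) = r' * (c' * c) * r" by (simp only: mult.assoc)
    then show "r' * c' * (c * r) = e" using r'_in c' by (simp add: r_inv e_right)
  qed (use bE assms Eu_E in auto)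
qed

text \<open>The multiplicative group of the fixed field of \<open>\<sigma>\<close> in
  \<open>E\<close>.\<close>

definition E0u :: "'a set" where
  "E0u = {t \<in> Eu. t * r = r * t}"

text \<open>Lying in \<open>E\<close>, the power commutes with \<open>c\<close>; it also commutes
  with \<open>c * r\<close>, hence with \<open>r\<close> after cancelling \<open>c\<close>. Up to
  the factor \<open>r ^ d\<close> it is the norm of \<open>c\<close>.\<close>

lemma coset_power_E0u:
  assumes "c \<in> Eu"
  shows "(c * r) ^ d \<in> E0u"
proof -
  have cE: "c \<in> E" using assms Eu_E by blast
  obtain h where h: "h \<in> E" "(c * r) ^ d = h * r ^ d"
    using coset_power[OF cE, of "d - 1"] d(1) by auto
  then have inE: "(c * r) ^ d \<in> E" using r_d_E E_closed(3) by simp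
  obtain v where v: "v \<in> A" "c * r * v = e" "v * (c * r) = e" using coset_inverse[OF assms] by metis
  have "(c * r) ^ d * v ^ d = e"
    using power_mult_distrib_commuting[of "c * r" v d] v e_power[OF d(1)] by simp
  then have nz: "(c * r) ^ d \<noteq> 0" using e_neq_0 by auto
  have "c * (r * (c * r) ^ d) = (c * r) ^ d * c * r"
    by (simp add: power_commutes flip: mult.assoc) (simp add: power_commutes mult.assoc)
  also have "\<dots> = c * ((c * r) ^ d * r)"
    using E_commute[OF cE inE] by (metis mult.assoc)
  finally have "r * (c * r) ^ d = (c * r) ^ d * r"
    using Eu_cancel_left[OF assms] inE E_A r_in by blast
  then show ?thesis using inE nz by (simp add: E0u_def Eu_def)
qed

lemma coset_conjugate:
  assumes "c \<in> Eu" "b \<in> Eu" "(b * r) ^ d = (c * r) ^ d"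
  shows "\<exists>t\<in>Eu. c * \<sigma> t = t * b"
proof -
  have cE: "c \<in> E" and bE: "b \<in> E" using assms Eu_E by auto
  obtain v where v: "v \<in> A" "b * r * v = e" "v * (b * r) = e"
    and conj: "\<And>t a. t \<in> E \<Longrightarrow> a \<in> E \<Longrightarrow> a * r * t * v \<in> E"
    using coset_inverse[OF assms(2)] by metis
  have A: "c * r \<in> A" "b * r \<in> A" using cE bE E_A r_in by auto
  have "(c * r) ^ d \<in> E" using coset_power_E0u[OF assms(1)] by (simp add: E0u_def Eu_def)
  then have central: "(c * r) ^ d * u = u * (c * r) ^ d" if "u \<in> E" for u
    using E_commute that by blast
  obtain u where u: "u \<in> E" and nz: "(\<Sum>i<d. (c * r) ^ i * u * v ^ i) \<noteq> 0"
    and eq: "(c * r) * (\<Sum>i<d. (c * r) ^ i * u * v ^ i) = (\<Sum>i<d. (c * r) ^ i * u * v ^ i) * (b * r)"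
    by (rule hilbert90[OF A(1) coset_commute[OF cE] A(2) v assms(3)[symmetric] central])
  define t where "t = (\<Sum>i<d. (c * r) ^ i * u * v ^ i)"
  have "(c * r) ^ i * u * v ^ i \<in> E" for i
  proof (induction i)
    case (Suc i)
    have "(c * r) ^ Suc i * u * v ^ Suc i = c * r * ((c * r) ^ i * u * v ^ i) * v"
      by (metis mult.assoc power_Suc power_Suc2)
    then show ?case using conj[OF Suc cE] by simp
  qed (use u in simp)
  then have t: "t \<in> Eu" using nz E_sum[of "{..<d}"] by (auto simp: t_def Eu_def)
  have "c * r * t = t * (b * r)" using eq by (simp add: t_def)
  then have "(c * \<sigma> t) * r = (t * b) * r"
    using r_sigma[OF E_A[OF Eu_E[OF t]]] by (simp add: mult.assoc)
  then have "c * \<sigma> t = t * b"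
    using r_cancel_right E_closed(3) sigma_E t cE bE E_A Eu_E by metis
  with t show ?thesis by blast
qed

lemma coset_power_neq_e:
  assumes "c \<in> Eu"
  shows "(c * r) ^ d \<noteq> e"
proof
  assume 1: "(c * r) ^ d = e"
  let ?w = "c * r"
  have cE: "c \<in> E" using assms Eu_E by blast
  have w: "?w \<in> A" using cE E_A r_in by auto
  have ee: "e * e = e" by (rule e_left[OF e_in])
  have we: "?w ^ d = e ^ d" using 1 e_power[OF d(1)] by simp
  have central: "?w ^ d * u = u * ?w ^ d" if "u \<in> E" for u
    unfolding 1 by (rule E_commute[OF e_E that])
  obtain u where u: "u \<in> E" "(\<Sum>i<d. ?w ^ i * u * e ^ i) \<noteq> 0"
    "?w * (\<Sum>i<d. ?w ^ i * u * e ^ i) = (\<Sum>i<d. ?w ^ i * u * e ^ i) * e"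
    by (rule hilbert90[OF w coset_commute[OF cE] e_in e_in ee ee we central])
  define t where "t = (\<Sum>i<d. ?w ^ i * u * e ^ i)"
  have tA: "t \<in> A" unfolding t_def
    using w e_in E_A[OF u(1)] by (intro subrng_sum subrng_mult_power subrng_A)
  have "?w * t = t * e" using u(3) by (simp only: t_def)
  then have ann: "(?w - e) * t = 0" using tA by (simp add: left_diff_distrib e_left e_right)
  have we: "?w - e \<in> A" using w e_in by auto
  have "(?w - e) ^ n * t = 0" if "n > 0" for n
    using that by (cases n) (simp_all add: power_Suc2 mult.assoc ann del: power_Suc)
  then have "\<not> (\<exists>n>0. (?w - e) ^ n = e)"
    using u(2) e_left[OF tA] by (metis t_def)
  then obtain k where "(?w - e) ^ k = 0" using unit_or_nilpotent[OF we] by blast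
  then have "(?w - e) * s = s * (?w - e)" using nilpotent_central we s_in by blast
  then have "?w * s = s * ?w" using s_in by (simp add: algebra_simps e_left e_right)
  then have "c * (r * s) = c * (s * r)" using E_commute[OF cE s_E] by (metis mult.assoc)
  then have "r * s = s * r" using Eu_cancel_left[OF assms] r_in s_in by blast
  then show False using r_s by simp
qed

text \<open>Counting the fibres of \<open>c \<mapsto> (c r)\<^sup>d\<close> shows that this map, essentially the norm, is onto, in
  particular attains \<open>e\<close>.\<close>

lemma no_normalized_field: False
proof -
  define f where "f c = (c * r) ^ d" for c
  define F where "F c = {b \<in> Eu. f b = f c}" for c
  have E0sub: "E0u \<subseteq> Eu" by (auto simp: E0u_def)
  have finE0: "finite E0u" using E0sub finite_E(2) finite_subset by blast
  \<comment> \<open>Each \<open>b\<close> in the fibre is determined by any \<open>t\<close> with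
    \<open>c * \<sigma> t = t * b\<close>, and multiplying \<open>t\<close> by an element of the
    fixed field preserves this equation. So the pairs \<open>(b, z)\<close> inject into
    \<open>Eu\<close> via \<open>T b * z\<close>.\<close>
  have fib: "card (F c) * card E0u \<le> card Eu" if c: "c \<in> Eu" for c
  proof -
    have "\<forall>b\<in>F c. \<exists>t\<in>Eu. c * \<sigma> t = t * b"
      using coset_conjugate[OF c] by (auto simp: F_def f_def)
    then obtain T where T: "\<And>b. b \<in> F c \<Longrightarrow> T b \<in> Eu" "\<And>b. b \<in> F c \<Longrightarrow> c * \<sigma> (T b) = T b * b"
      by metis
    define g where "g = (\<lambda>(b, z). T b * z)"
    have gEu: "g x \<in> Eu" if "x \<in> F c \<times> E0u" for x
      using that T Eu_mult E0sub by (auto simp: g_def)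
    have recover: "c * \<sigma> (g (b, z)) = g (b, z) * b" if b: "b \<in> F c" and z: "z \<in> E0u" for b z
    proof -
      have zE: "z \<in> E" and bE: "b \<in> E" and TE: "T b \<in> E"
        using b z T(1) E0sub Eu_E by (auto simp: F_def)
      have "\<sigma> z * r = z * r" using z r_sigma[OF E_A[OF zE]] by (simp add: E0u_def)
      then have "\<sigma> z = z" using r_cancel_right E_A sigma_E zE by blast
      then have "c * \<sigma> (T b * z) = T b * b * z"
        using sigma_mult E_A TE zE T(2)[OF b] by (simp add: flip: mult.assoc)
      also have "\<dots> = T b * z * b" using E_commute[OF bE zE] by (simp add: mult.assoc)
      finally show ?thesis by (simp add: g_def)
    qed
    have "inj_on g (F c \<times> E0u)"
    proof (rule inj_onI, clarify)
      fix b z b' z' assume bz: "b \<in> F c" "z \<in> E0u" "b' \<in> F c" "z' \<in> E0u" and eq: "g (b, z) = g (b', z')"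
      have A: "b \<in> A" "b' \<in> A" "z \<in> A" "z' \<in> A"
        using bz E0sub by (auto simp: F_def Eu_def E_def)
      have "g (b, z) * b = g (b, z) * b'" using recover bz eq by metis
      then have "b = b'" using Eu_cancel_left[OF gEu] bz A by blast
      moreover from this eq have "z = z'" using Eu_cancel_left[OF T(1)] bz A by (auto simp: g_def)
      ultimately show "b = b' \<and> z = z'" by simp
    qed
    then have "card (F c \<times> E0u) \<le> card Eu"
      using gEu finite_E(2) by (intro card_inj_on_le[of g]) auto
    then show ?thesis by (simp add: card_cartesian_product)
  qed
  have "card Eu = (\<Sum>v\<in>f ` Eu. card {b \<in> Eu. f b = v})"
    using sum.image_gen[OF finite_E(2), of "\<lambda>_. 1::nat" f] by simp
  then have "card Eu * card E0u = (\<Sum>v\<in>f ` Eu. card {b \<in> Eu. f b = v} * card E0u)"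
    by (simp add: sum_distrib_right)
  also have "\<dots> \<le> (\<Sum>v\<in>f ` Eu. card Eu)"
    using fib by (intro sum_mono) (auto simp: F_def)
  also have "\<dots> = card (f ` Eu) * card Eu" by simp
  \<comment> \<open>After cancelling \<open>card Eu\<close>, the image has at least as many elements
    as \<open>E0u\<close>, yet it is contained in \<open>E0u\<close> without
    \<open>e\<close>.\<close>
  finally have "card E0u \<le> card (f ` Eu)"
    using e_Eu finite_E(2) by (auto simp: mult.commute card_gt_0_iff)
  moreover have "f ` Eu \<subseteq> E0u - {e}"
    using coset_power_E0u coset_power_neq_e by (auto simp: f_def)
  moreover have "e \<in> E0u" using e_Eu r_in by (simp add: E0u_def e_left e_right)
  ultimately show False
    using finE0 by (metis card_Diff1_less card_mono finite_Diff leD le_trans)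
qed

end

theorem (in centralizer_commutative_ring) commutative: "commutative_on A"
proof (rule ccontr)
  assume "\<not> ?thesis"
  then obtain s y where "s \<in> A" "y \<in> A" "s ^ q = s" "s * y \<noteq> y * s"
    by (rule noncommuting_frob_fixed)
  then interpret centralizer_field A e q s y by unfold_locales
  obtain r r' where "r \<in> A" "r' \<in> A" "r * r' = e" "r' * r = e" "r ^ q = r"
    "\<And>t. t \<in> E \<Longrightarrow> r * t * r' \<in> E" "r * s \<noteq> s * r"
    by (rule exists_normalizing_unit) blast
  then interpret normalized_field A e q s y r r' by unfold_locales
  show False by (rule no_normalized_field)
qed

text \<open>In a minimal noncommutative subring the centralizers of noncentral elements are proper, hence
  commutative, and every idempotent is \<open>0\<close> or the identity.\<close>

theorem finite_ring_commutative:
  fixes A :: "'a::ring_1 set"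
  assumes "Factorial_Ring.prime (p::nat)" "of_nat p = (0::'a)" "finite A" "subrng A"
    and nil: "\<And>a b k. a \<in> A \<Longrightarrow> a ^ k = 0 \<Longrightarrow> b \<in> A \<Longrightarrow> a * b = b * a"
    and idem: "\<And>a b. a \<in> A \<Longrightarrow> a * a = a \<Longrightarrow> b \<in> A \<Longrightarrow> a * b = b * a"
  shows "commutative_on A"
proof (rule ccontr)
  assume "\<not> commutative_on A"
  then have "\<exists>B. B \<subseteq> A \<and> subrng B \<and> \<not> commutative_on B" using assms(4) by blast
  then obtain B0 where "B0 \<subseteq> A \<and> subrng B0 \<and> \<not> commutative_on B0" by blast
  from ex_has_least_nat[of "\<lambda>B. B \<subseteq> A \<and> subrng B \<and> \<not> commutative_on B", OF this, of card]
  obtain B where B: "B \<subseteq> A" "subrng B" "\<not> commutative_on B"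
    and min: "\<And>C. C \<subseteq> A \<Longrightarrow> subrng C \<Longrightarrow> \<not> commutative_on C \<Longrightarrow> card B \<le> card C"
    by blast
  have finB: "finite B" using B(1) assms(3) finite_subset by blast
  have proper: "commutative_on C" if "C \<subset> B" "subrng C" for C
    using min[of C] that B(1) psubset_card_mono[OF finB that(1)] by fastforce
  note cl = subrng_closed[OF B(2)]
  have idem_B: "a * b = b * a" if "a \<in> B" "a * a = a" "b \<in> B" for a b
    using idem that B(1) by blast
  \<comment> \<open>Otherwise the central idempotent \<open>f\<close> splits \<open>B\<close> into
    \<open>B1\<close> and \<open>B2\<close>. Both are proper, as \<open>a\<close> is not in
    \<open>B1\<close> and \<open>f\<close> is not in \<open>B2\<close>, so both are commutative, and
    then so is \<open>B\<close>.\<close>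
  have e_left: "f * a = a" if f: "f \<in> B" "f * f = f" "f \<noteq> 0" and a: "a \<in> B" for f a
  proof (rule ccontr)
    assume "f * a \<noteq> a"
    define B1 where "B1 = {x \<in> B. f * x = x}"
    define B2 where "B2 = {x \<in> B. f * x = 0}"
    have s: "subrng B1" "subrng B2"
      using cl by (auto simp: subrng_def B1_def B2_def algebra_simps simp flip: mult.assoc)
    have "a \<notin> B1" "f \<notin> B2" "B1 \<subseteq> B" "B2 \<subseteq> B"
      using \<open>f * a \<noteq> a\<close> f by (auto simp: B1_def B2_def)
    then have "commutative_on B1" "commutative_on B2"
      using proper[OF _ s(1)] proper[OF _ s(2)] a f by blast+
    moreover have "f * x \<in> B1" "x - f * x \<in> B2" if "x \<in> B" for x
      using that f cl by (auto simp: B1_def B2_def algebra_simps simp flip: mult.assoc)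
    ultimately have c: "f * x * (f * z) = f * z * (f * x)"
      "(x - f * x) * (z - f * z) = (z - f * z) * (x - f * x)" if "x \<in> B" "z \<in> B" for x z
      using that by (auto simp: commutative_on_def)
    have "x * z = f * x * (f * z) + (x - f * x) * (z - f * z)" if "x \<in> B" for x z
    proof -
      have "x * (f * z) = f * x * z" using idem_B[OF f(1,2) that] by (simp flip: mult.assoc)
      moreover have "f * x * (f * z) = f * x * z"
        using idem_B[OF f(1,2) that] f(2) by (metis mult.assoc)
      ultimately show ?thesis by (simp add: algebra_simps)
    qed
    then have "x * z = z * x" if "x \<in> B" "z \<in> B" for x z using c that by metis
    then show False using B(3) by (auto simp: commutative_on_def)
  qed
  obtain a b where ab: "a \<in> B" "b \<in> B" "a * b \<noteq> b * a"
    using B(3) by (auto simp: commutative_on_def)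
  obtain n where n: "n > 0" "a ^ n * a ^ n = a ^ n"
    using finite_power_idempotent[OF finB B(2) ab(1)] by blast
  define e where "e = a ^ n"
  have e0: "e \<noteq> 0" using nil[of a n b] ab B(1) by (auto simp: e_def)
  have eB: "e \<in> B" using subrng_power[OF B(2) ab(1) n(1)] by (simp add: e_def)
  have ee: "e * e = e" using n(2) by (simp add: e_def)
  have el: "e * x = x" if "x \<in> B" for x
    by (rule e_left[OF eB ee e0 that])
  \<comment> \<open>The iterated \<open>p\<close>-th power maps on \<open>B\<close> are finitely
    many functions; an idempotent one among them, with exponent \<open>p ^ M\<close>, supplies
    \<open>q\<close>.\<close>
  define h where "h m = restrict (\<lambda>x. x ^ (p ^ m)) B" for m
  have ppos: "p > 1" using assms(1) prime_gt_1_nat by blast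
  have "h m \<in> B \<rightarrow>\<^sub>E B" for m
    unfolding h_def restrict_PiE_iff using subrng_power[OF B(2)] ppos by simp
  then have "range h \<subseteq> B \<rightarrow>\<^sub>E B" by blast
  then have "finite (range h)"
    by (rule finite_subset) (use finB in \<open>intro finite_PiE\<close>)
  moreover have "h (i + k) = h (j + k)" if "h i = h j" for i j k
  proof
    fix x
    have "x ^ (p ^ i) = x ^ (p ^ j)" if "x \<in> B"
      using fun_cong[OF \<open>h i = h j\<close>, of x] that by (simp add: h_def)
    then show "h (i + k) x = h (j + k) x"
      by (simp add: h_def power_add power_mult restrict_def)
  qed
  ultimately obtain M where M: "M > 0" "h (M + M) = h M"
    using eventually_periodic_idempotent[of h] by blast
  interpret centralizer_commutative_ring B e "p ^ M"
  proof
    show "x * e = x" if "x \<in> B" for x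
      using el[OF that] idem_B[OF eB ee that] by simp
    show "(\<exists>k. x ^ k = 0) \<or> (\<exists>n>0. x ^ n = e)" if x: "x \<in> B" for x
    proof -
      obtain m where m: "m > 0" "x ^ m * x ^ m = x ^ m"
        using finite_power_idempotent[OF finB B(2) x] by blast
      have xm: "x ^ m \<in> B" using subrng_power[OF B(2) x m(1)] .
      have "x ^ m = e" if "x ^ m \<noteq> 0"
        using e_left[OF xm m(2) that eB] idem_B[OF xm m(2) eB] el[OF xm] by simp
      then show ?thesis using m(1) by blast
    qed
    show "x * z = z * x" if "x \<in> B" "x ^ k = 0" "z \<in> B" for x z k
      using nil that B(1) by blast
    show "p ^ M > 1" using ppos M(1) by (rule one_less_power)
    show "(x ^ p ^ M) ^ p ^ M = x ^ p ^ M" if "x \<in> B" for x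
      using fun_cong[OF M(2), of x] that by (simp add: h_def power_add power_mult)
    show "b * c = c * b" if "x \<in> B" "z \<in> B" "x * z \<noteq> z * x" "b \<in> B" "c \<in> B" "x * b = b * x" "x * c = c * x"
      for x b c z
    proof -
      let ?C = "{w \<in> B. x * w = w * x}"
      have "subrng ?C"
        using cl by (auto simp: subrng_def algebra_simps) (metis mult.assoc)
      moreover have "?C \<subset> B" using that by blast
      ultimately have "commutative_on ?C" by (intro proper)
      moreover have "b \<in> ?C" "c \<in> ?C" using that by simp_all
      ultimately show ?thesis unfolding commutative_on_def by blast
    qed
  qed (use finB B(1,2) eB el frobenius_power_add_commuting[OF assms(1,2)] in auto)
  show False using commutative B(3) by blast
qed

section \<open>Torsion units with finitely many conjugates\<close>

lemma geometric_sum_ring: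
  fixes x :: "'a::ring_1"
  shows "(1 - x) * (\<Sum>i<k. x ^ i) = 1 - x ^ k" and "(\<Sum>i<k. x ^ i) * (1 - x) = 1 - x ^ k"
proof -
  show "(1 - x) * (\<Sum>i<k. x ^ i) = 1 - x ^ k"
  proof (induction k)
    case (Suc k)
    have "(1 - x) * (\<Sum>i<Suc k. x ^ i) = (1 - x) * (\<Sum>i<k. x ^ i) + (1 - x) * x ^ k"
      by (simp add: distrib_left)
    then show ?case unfolding Suc by (simp add: left_diff_distrib)
  qed simp
  show "(\<Sum>i<k. x ^ i) * (1 - x) = 1 - x ^ k"
  proof (induction k)
    case (Suc k)
    have "(\<Sum>i<Suc k. x ^ i) * (1 - x) = (\<Sum>i<k. x ^ i) * (1 - x) + x ^ k * (1 - x)"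
      by (simp add: distrib_right)
    then show ?case unfolding Suc by (simp add: right_diff_distrib power_commutes)
  qed simp
qed

text \<open>The rewriting step of Dietzmann's lemma: moving \<open>x\<close> to the front across a
  letter \<open>a\<close> replaces \<open>a\<close> by another letter of \<open>S\<close>, so the
  total length is preserved.\<close>

lemma collect_factors:
  fixes x :: "'a::monoid_mult"
  assumes "\<And>a. a \<in> S \<Longrightarrow> \<exists>b\<in>S. a * x = x * b" "set ws \<subseteq> S" "k \<le> count_list ws x"
  shows "\<exists>vs. set vs \<subseteq> S \<and> length vs + k = length ws \<and> prod_list ws = x ^ k * prod_list vs"
  using assms(2,3)
proof (induction ws arbitrary: k)
  case (Cons a ws)
  have shift: "\<exists>b\<in>S. a * x ^ n = x ^ n * b" if "a \<in> S" for a n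
    using that
  proof (induction n arbitrary: a)
    case (Suc n)
    then obtain b where b: "b \<in> S" "a * x = x * b" using assms(1) by blast
    then obtain c where "c \<in> S" "b * x ^ n = x ^ n * c" using Suc.IH by blast
    with b have "c \<in> S" "a * x ^ Suc n = x ^ Suc n * c" by (auto simp: mult.assoc) (metis mult.assoc)
    then show ?case by blast
  qed auto
  consider "k = 0" | j where "k = Suc j" "a = x" | "k \<noteq> 0" "a \<noteq> x"
    by (cases k) auto
  then show ?case
  proof cases
    case 1
    then show ?thesis using Cons.prems(1) by (intro exI[of _ "a # ws"]) simp
  next
    case (2 j)
    then obtain vs where "set vs \<subseteq> S" "length vs + j = length ws" "prod_list ws = x ^ j * prod_list vs"
      using Cons.IH[of j] Cons.prems by auto
    then show ?thesis using 2 by (intro exI[of _ vs]) (simp add: mult.assoc)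
  next
    case 3
    then obtain vs where vs: "set vs \<subseteq> S" "length vs + k = length ws" "prod_list ws = x ^ k * prod_list vs"
      using Cons.IH[of k] Cons.prems by auto
    obtain b where b: "b \<in> S" "a * x ^ k = x ^ k * b" using shift[of a] Cons.prems(1) by auto
    have "prod_list (a # ws) = x ^ k * prod_list (b # vs)"
      using b(2) vs(3) by simp (metis mult.assoc)
    then show ?thesis using b(1) vs by (intro exI[of _ "b # vs"]) simp
  qed
qed auto

text \<open>Closure under sums only: in characteristic \<open>p\<close> the negative of an element
  is its \<open>(p - 1)\<close>-fold sum, so the generated additive group is obtained.\<close>

inductive_set additive_span :: "'a::ring_1 set \<Rightarrow> 'a set" for M where
  zero: "0 \<in> additive_span M"
| add: "a \<in> additive_span M \<Longrightarrow> m \<in> M \<Longrightarrow> a + m \<in> additive_span M"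

lemma additive_span_base: "m \<in> M \<Longrightarrow> m \<in> additive_span M"
  using additive_span.add[OF additive_span.zero] by fastforce

lemma additive_span_add:
  assumes "b \<in> additive_span M" "a \<in> additive_span M"
  shows "a + b \<in> additive_span M"
  using assms by (induction) (auto intro: additive_span.intros simp flip: add.assoc)

text \<open>Coefficients matter only modulo \<open>p\<close>, so the finitely many functions from
  \<open>M\<close> to \<open>{..<p}\<close> account for all sums.\<close>

lemma finite_additive_span:
  fixes M :: "'a::ring_1 set"
  assumes "finite M" "of_nat p = (0::'a)" "p > 0"
  shows "finite (additive_span M)"
proof -
  define S where "S f = (\<Sum>m\<in>M. of_nat (f m) * m)" for f
  have "a \<in> S ` (M \<rightarrow>\<^sub>E {..<p})" if "a \<in> additive_span M" for a
    using that
  proof induction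
    case zero
    show ?case
      by (rule image_eqI[of _ _ "restrict (\<lambda>_. 0) M"]) (use assms(3) in \<open>auto simp: S_def\<close>)
  next
    case (add a m)
    then obtain f where f: "a = S f" "f \<in> M \<rightarrow>\<^sub>E {..<p}" by blast
    have mod: "of_nat (i mod p) = (of_nat i :: 'a)" for i
    proof -
      have "of_nat i = (of_nat (p * (i div p) + i mod p) :: 'a)" by simp
      then show ?thesis unfolding of_nat_add of_nat_mult assms(2) by simp
    qed
    define g where "g = f(m := (f m + 1) mod p)"
    have "S g = of_nat (g m) * m + (\<Sum>k\<in>M - {m}. of_nat (g k) * k)"
      unfolding S_def by (rule sum.remove[OF assms(1) add.hyps(2)])
    also have "(\<Sum>k\<in>M - {m}. of_nat (g k) * k) = (\<Sum>k\<in>M - {m}. of_nat (f k) * k)"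
      by (rule sum.cong) (auto simp: g_def)
    also have "of_nat (g m) * m = of_nat (f m) * m + m"
      by (simp add: g_def mod distrib_right add.commute del: of_nat_Suc) (simp add: distrib_right)
    also have "of_nat (f m) * m + m + (\<Sum>k\<in>M - {m}. of_nat (f k) * k) = S f + m"
      unfolding S_def sum.remove[OF assms(1) add.hyps(2), of "\<lambda>k. of_nat (f k) * k"]
      by (simp add: add_ac)
    finally have "a + m = S g" by (simp add: f)
    moreover have "g \<in> M \<rightarrow>\<^sub>E {..<p}" using f add.hyps(2) assms(3) by (auto simp: g_def)
    ultimately show ?case by blast
  qed
  then have "additive_span M \<subseteq> S ` (M \<rightarrow>\<^sub>E {..<p})" by blast
  then show ?thesis
    by (rule finite_subset) (use assms(1) in \<open>intro finite_imageI finite_PiE\<close>, auto)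
qed

lemma subrng_additive_span:
  fixes M :: "'a::ring_1 set"
  assumes "of_nat p = (0::'a)" "p > 0" and closed: "\<And>a b. a \<in> M \<Longrightarrow> b \<in> M \<Longrightarrow> a * b \<in> M"
  shows "subrng (additive_span M)"
  unfolding subrng_def
proof (intro conjI ballI)
  show "0 \<in> additive_span M" by (rule additive_span.zero)
  fix a b assume a: "a \<in> additive_span M" and b: "b \<in> additive_span M"
  have n: "of_nat n * b \<in> additive_span M" for n
    by (induction n) (auto simp: distrib_right intro: additive_span.zero additive_span_add b)
  have "of_nat (Suc (p - 1)) * b = 0" using assms by simp
  then have "of_nat (p - 1) * b = - b" by (simp add: distrib_right eq_neg_iff_add_eq_0 add.commute)
  then show "a - b \<in> additive_span M" using additive_span_add[OF n[of "p - 1"] a] by simp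
  have right: "a * m \<in> additive_span M" if "m \<in> M" for m
    using a by induction (auto simp: distrib_right intro: additive_span.intros closed that)
  show "a * b \<in> additive_span M"
    using b by induction (auto simp: distrib_left intro: additive_span_add additive_span.zero right)
qed

section \<open>Units and conjugates relative to an identity \<open>e\<close>\<close>

locale unital_subrng =
  fixes R :: "'a::ring_1 set" and e :: 'a
  assumes subrng_R: "subrng R" and e_in: "e \<in> R"
    and e_left: "\<And>a. a \<in> R \<Longrightarrow> e * a = a" and e_right: "\<And>a. a \<in> R \<Longrightarrow> a * e = a"
begin

lemmas R_closed = subrng_0[OF subrng_R] subrng_diff[OF subrng_R] subrng_mult[OF subrng_R]
  subrng_uminus[OF subrng_R] subrng_add[OF subrng_R]

definition inverse_pair :: "'a \<Rightarrow> 'a \<Rightarrow> bool" where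
  "inverse_pair w v \<longleftrightarrow> w \<in> R \<and> v \<in> R \<and> w * v = e \<and> v * w = e"

definition conjugates :: "'a \<Rightarrow> 'a set" where
  "conjugates x = {w * x * v | w v. inverse_pair w v}"

lemma conjugates_R: "x \<in> R \<Longrightarrow> conjugates x \<subseteq> R"
  by (auto simp: conjugates_def inverse_pair_def intro: R_closed)

lemma conjugates_refl: "x \<in> R \<Longrightarrow> x \<in> conjugates x"
  unfolding conjugates_def inverse_pair_def
  by (auto intro!: exI[of _ e] simp: e_in e_left e_right)

lemma conjugates_trans:
  assumes "z \<in> conjugates x" "inverse_pair w v"
  shows "w * z * v \<in> conjugates x"
proof -
  obtain w' v' where z: "z = w' * x * v'" "inverse_pair w' v'"
    using assms(1) by (auto simp: conjugates_def)
  have "(w * w') * (v' * v) = w * (w' * v') * v" "(v' * v) * (w * w') = v' * (v * w) * w'"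
    by (simp_all only: mult.assoc)
  then have "inverse_pair (w * w') (v' * v)"
    using z(2) assms(2) by (auto simp: inverse_pair_def e_right intro: R_closed)
  moreover have "w * z * v = (w * w') * x * (v' * v)" by (simp add: z(1) mult.assoc)
  ultimately show ?thesis unfolding conjugates_def by blast
qed

lemma conjugate_power_one:
  assumes "z \<in> conjugates x" "x \<in> R" "x ^ n = e" "n > 0"
  shows "z ^ n = e"
proof -
  obtain w v where z: "z = w * x * v" and wv: "inverse_pair w v"
    using assms(1) by (auto simp: conjugates_def)
  have "z ^ Suc k = w * x ^ Suc k * v" for k
  proof (induction k)
    case (Suc k)
    have "z ^ Suc (Suc k) = w * x * (v * w) * (x ^ Suc k * v)"
      unfolding power_Suc[of z "Suc k"] Suc by (simp only: z mult.assoc)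
    also have "\<dots> = w * (x * x ^ Suc k) * v"
      using wv assms(2) by (simp add: inverse_pair_def mult.assoc) (metis mult.assoc e_right)
    finally show ?case by simp
  qed (simp add: z)
  from this[of "n - 1"] show ?thesis using assms(3,4) wv by (simp add: inverse_pair_def e_right)
qed

text \<open>The mechanism of the proof: if the units \<open>b + \<tau>\<^sub>i a\<close> conjugate \<open>x\<close> into a finite set, then one
  conjugate \<open>z\<close> occurs infinitely often, and the relation \<open>(b + \<tau>\<^sub>i a) x = z (b + \<tau>\<^sub>i a)\<close> splits.\<close>

lemma conjugation_splits:
  assumes "x \<in> R" "a \<in> R" "b \<in> R" and fin: "finite (conjugates x)" and "infinite I"
    and unit: "\<And>i. i \<in> I \<Longrightarrow> \<exists>v. inverse_pair (b + \<tau> i * a) v"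
    and comm: "\<And>i z. i \<in> I \<Longrightarrow> z \<in> conjugates x \<Longrightarrow> \<tau> i * z = z * \<tau> i"
    and separate: "\<And>v w. v \<in> R \<Longrightarrow> w \<in> R \<Longrightarrow> infinite {i \<in> I. \<tau> i * v = w} \<Longrightarrow> v = 0"
  obtains z where "z \<in> R" "a * x = z * a" "b * x = z * b"
proof -
  obtain V where V: "\<And>i. i \<in> I \<Longrightarrow> inverse_pair (b + \<tau> i * a) (V i)"
    using unit by metis
  define c where "c i = (b + \<tau> i * a) * x * V i" for i
  have c: "c i \<in> conjugates x" if "i \<in> I" for i
    using V[OF that] by (auto simp: c_def conjugates_def)
  then have "c ` I \<subseteq> conjugates x" by blast
  then have "finite (c ` I)" using fin by (rule finite_subset)
  from pigeonhole_infinite[OF assms(5) this]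
  obtain j where j: "j \<in> I" "infinite {i \<in> I. c i = c j}" by blast
  define z where "z = c j"
  have z: "z \<in> conjugates x" using c[OF j(1)] by (simp add: z_def)
  then have zR: "z \<in> R" using conjugates_R[OF assms(1)] by blast
  \<comment> \<open>As \<open>\<tau> i\<close> commutes with \<open>z\<close>, the conjugation
    relation sorts into a multiple of \<open>\<tau> i\<close> and a part independent of
    \<open>i\<close>, the form that \<open>separate\<close> handles.\<close>
  have "\<tau> i * (a * x - z * a) = z * b - b * x" if i: "i \<in> I" "c i = c j" for i
  proof -
    let ?w = "b + \<tau> i * a"
    have V: "?w \<in> R" "V i \<in> R" "V i * ?w = e" using V[OF i(1)] by (auto simp: inverse_pair_def)
    have "z * ?w = c i * ?w" by (simp only: z_def i(2))
    also have "\<dots> = ?w * x * (V i * ?w)" by (simp only: c_def mult.assoc)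
    also have "\<dots> = ?w * x" unfolding V(3) by (rule e_right) (use V(1) assms(1) in \<open>rule R_closed\<close>)
    finally have "z * ?w = ?w * x" .
    moreover have "\<tau> i * (z * a) = z * (\<tau> i * a)"
      using comm[OF i(1) z] by (simp flip: mult.assoc)
    ultimately show ?thesis by (simp add: algebra_simps)
  qed
  then have sub: "{i \<in> I. c i = c j} \<subseteq> {i \<in> I. \<tau> i * (a * x - z * a) = z * b - b * x}" by blast
  have "infinite {i \<in> I. \<tau> i * (a * x - z * a) = z * b - b * x}"
    using infinite_super[OF sub j(2)] .
  then have inf: "a * x - z * a = 0"
    by (rule separate[rotated 2]) (intro R_closed assms(1-3) zR)+
  moreover have "z * b - b * x = 0" using sub j(1) inf by auto
  ultimately show ?thesis using that[of z] zR by simp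
qed

theorem torsion_FC_commute_infinite_field:
  fixes \<kappa> :: "'k::field \<Rightarrow> 'a"
  assumes "infinite (UNIV :: 'k set)"
    and \<kappa>: "\<And>c. \<kappa> c \<in> R" "\<And>c d. \<kappa> (c + d) = \<kappa> c + \<kappa> d" "\<And>c d. \<kappa> (c * d) = \<kappa> c * \<kappa> d" "\<kappa> 1 = e"
      "\<And>c a. a \<in> R \<Longrightarrow> \<kappa> c * a = a * \<kappa> c"
    and x: "x \<in> R" "finite (conjugates x)" and y: "y \<in> R" "y ^ n = e" "n > 0"
  shows "x * y = y * x"
proof -
  \<comment> \<open>For these scalars \<open>e - \<kappa> c * y\<close> is invertible:
    \<open>N = \<kappa> c * y\<close> satisfies \<open>N ^ n = \<kappa> (c ^ n)\<close>, so the
    geometric sum of \<open>N\<close> divided by \<open>1 - c ^ n\<close> is an inverse. Only the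
    roots of a nonzero polynomial are lost.\<close>
  define I where "I = {c::'k. c ^ n \<noteq> 1}"
  have "finite {c::'k. c ^ n = 1}"
  proof -
    have "poly (monom 1 n - 1 :: 'k poly) 0 \<noteq> 0" using y(3) by (simp add: poly_monom zero_power)
    then have "monom 1 n - 1 \<noteq> (0 :: 'k poly)" by (metis poly_0)
    then have "finite {c. poly (monom 1 n - 1 :: 'k poly) c = 0}" by (rule poly_roots_finite)
    then show ?thesis by (simp add: poly_monom)
  qed
  moreover have "I = UNIV - {c. c ^ n = 1}" by (auto simp: I_def)
  ultimately have inf: "infinite I" using assms(1) by (simp add: Diff_infinite_finite)
  have diff: "\<kappa> (c - d) = \<kappa> c - \<kappa> d" for c d using \<kappa>(2)[of "c - d" d] by simp
  have unit: "\<exists>v. inverse_pair (e + \<kappa> c * - y) v" if c: "c \<in> I" for c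
    proof -
      define N where "N = \<kappa> c * y"
      define S where "S = (\<Sum>i<n. N ^ i)"
      define k where "k = \<kappa> (inverse (1 - c ^ n))"
      have NR: "N \<in> R" unfolding N_def by (intro R_closed \<kappa>(1) y(1))
      have kR: "k \<in> R" by (simp add: k_def \<kappa>(1))
      have "\<kappa> c ^ Suc m = \<kappa> (c ^ Suc m)" for m
        by (induction m) (simp_all add: \<kappa>(3))
      then have "\<kappa> c ^ n = \<kappa> (c ^ n)" using y(3) by (cases n) auto
      then have Nn: "N ^ n = \<kappa> (c ^ n)"
        using power_mult_distrib_commuting[OF \<kappa>(5)[OF y(1)], of c n] \<kappa>(1) by (simp add: N_def y(2) e_right)
      have kN: "k * (1 - N ^ n) = e"
      proof -
        have "k * (1 - N ^ n) = k * e - k * \<kappa> (c ^ n)" using kR by (simp add: Nn right_diff_distrib e_right)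
        also have "\<dots> = \<kappa> (inverse (1 - c ^ n) * (1 - c ^ n))"
          by (simp only: k_def \<kappa>(3,4) diff right_diff_distrib)
        also have "inverse (1 - c ^ n) * (1 - c ^ n) = 1" using c by (simp add: I_def)
        finally show ?thesis by (simp add: \<kappa>(4))
      qed
      have kS: "k * S \<in> R" unfolding S_def sum_distrib_left
        by (intro subrng_sum subrng_mult_power subrng_R kR NR)
      have "(e - N) * (k * S) = (1 - N) * k * S"
        using kS e_left by (simp add: left_diff_distrib mult.assoc)
      also have "\<dots> = k * ((1 - N) * S)"
      proof -
        have "(1 - N) * k = k * (1 - N)"
          using \<kappa>(5)[OF NR] by (simp add: k_def left_diff_distrib right_diff_distrib)
        then show ?thesis by (simp only: mult.assoc)
      qed
      finally have 1: "(e - N) * (k * S) = e" by (simp add: S_def geometric_sum_ring kN)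
      have "(k * S) * (e - N) = k * S - k * S * N"
        by (simp only: right_diff_distrib e_right[OF kS])
      also have "\<dots> = k * (S * (1 - N))" by (simp add: right_diff_distrib mult.assoc)
      finally have 2: "(k * S) * (e - N) = e" by (simp add: S_def geometric_sum_ring kN)
      have "inverse_pair (e - N) (k * S)"
        unfolding inverse_pair_def using 1 2 kS NR e_in R_closed(2) by blast
      then show ?thesis by (auto simp: N_def)
    qed
  have comm: "\<kappa> c * z = z * \<kappa> c" if "z \<in> conjugates x" for c z
      using \<kappa>(5) conjugates_R[OF x(1)] that by blast
  \<comment> \<open>Two distinct scalars with the same product suffice, their difference being
    invertible.\<close>
  have separate: "v = 0" if v: "v \<in> R" and i: "infinite {c \<in> I. \<kappa> c * v = w}" for v w
    proof -
      obtain c where c: "c \<in> {c \<in> I. \<kappa> c * v = w}" using infinite_imp_nonempty[OF i] by blast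
      obtain d where d: "d \<in> {c \<in> I. \<kappa> c * v = w} - {c}"
        using infinite_imp_nonempty[OF infinite_remove[OF i, of c]] by blast
      have "\<kappa> (c - d) * v = 0" using c d by (simp add: diff left_diff_distrib)
      then have "\<kappa> (inverse (c - d) * (c - d)) * v = 0" by (simp add: \<kappa>(3) mult.assoc)
      moreover have "inverse (c - d) * (c - d) = 1" using d by auto
      ultimately show "v = 0" using v by (simp add: \<kappa>(4) e_left)
    qed
  \<comment> \<open>The relation for \<open>e\<close> identifies \<open>z\<close> with
    \<open>x\<close>; the relation for \<open>- y\<close> is then the claim.\<close>
  obtain z where "z \<in> R" "- y * x = z * - y" "e * x = z * e"
    by (rule conjugation_splits[OF x(1) R_closed(4)[OF y(1)] e_in x(2) inf unit comm separate])
  then show "x * y = y * x" using x(1) by (simp add: e_left e_right)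
qed

lemma power_in: "a \<in> R \<Longrightarrow> n > 0 \<Longrightarrow> a ^ n \<in> R"
  by (rule subrng_power[OF subrng_R])

lemma torsion_inverse_pair:
  assumes "x \<in> R" "x ^ n = e" "n > 0"
  obtains v where "inverse_pair x v"
proof -
  have "x ^ Suc (n + n - 1) = e"
    using assms e_left[OF e_in] by (simp add: power_add)
  then have "x * x ^ (n + n - 1) = e" "x ^ (n + n - 1) * x = e"
    by (simp_all add: power_commutes)
  moreover have "x ^ (n + n - 1) \<in> R" using assms by (intro power_in) auto
  ultimately show ?thesis using that assms(1) by (simp add: inverse_pair_def)
qed

lemma inverse_pair_commute:
  assumes "inverse_pair w v" "a \<in> R" "w * a = a * w"
  shows "v * a = a * v"
proof -
  have wv: "w \<in> R" "v \<in> R" "w * v = e" "v * w = e" using assms(1) by (auto simp: inverse_pair_def)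
  have "v * a = v * (a * w) * v" using wv assms(2) by (simp add: mult.assoc e_right)
  also have "\<dots> = (v * w) * (a * v)" by (simp only: assms(3)[symmetric] mult.assoc)
  also have "\<dots> = a * v" using wv assms(2) by (simp add: e_left R_closed)
  finally show ?thesis .
qed

theorem torsion_FC_commute_prime_char:
  fixes \<tau> :: "'i \<Rightarrow> 'a"
  assumes p: "Factorial_Ring.prime p" "of_nat p = (0 :: 'a)"
    and x: "x \<in> R" "finite (conjugates x)" "x ^ n = e" "n > 0"
    and y: "y \<in> R" "finite (conjugates y)" "y ^ m = e" "m > 0"
    and I: "infinite I"
    and unit: "\<And>i. i \<in> I \<Longrightarrow> \<exists>v. inverse_pair (\<tau> i) v"
    and comm: "\<And>i z. i \<in> I \<Longrightarrow> z \<in> conjugates x \<union> conjugates y \<Longrightarrow> \<tau> i * z = z * \<tau> i"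
    and separate: "\<And>v w. v \<in> R \<Longrightarrow> w \<in> R \<Longrightarrow> infinite {i \<in> I. \<tau> i * v = w} \<Longrightarrow> v = 0"
  shows "x * y = y * x"
proof -
  define S where "S = conjugates x \<union> conjugates y"
  define N where "N = n * m"
  have N: "N > 0" using x(4) y(4) by (simp add: N_def)
  have fin_S: "finite S" using x(2) y(2) by (simp add: S_def)
  have S_R: "S \<subseteq> R" using conjugates_R x(1) y(1) by (simp add: S_def)
  have S_conj: "conjugates z \<subseteq> S" if "z \<in> S" for z
  proof
    fix t assume "t \<in> conjugates z"
    then obtain w v where "t = w * z * v" "inverse_pair w v" unfolding conjugates_def by blast
    then show "t \<in> S" using that conjugates_trans by (auto simp: S_def)
  qed
  have one_power: "e ^ k = e" if "k > 0" for k
    using that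
  proof (induction k)
    case (Suc k)
    then show ?case using e_left[OF e_in] by (cases k) auto
  qed simp
  have S_pow: "z ^ N = e" if "z \<in> S" for z
  proof -
    have "z ^ n = e \<or> z ^ m = e"
      using that conjugate_power_one x y unfolding S_def by blast
    then show ?thesis
    proof
      assume "z ^ n = e"
      then show ?thesis using one_power[OF y(4)] by (simp add: N_def power_mult)
    next
      assume "z ^ m = e"
      then show ?thesis using one_power[OF x(4)] by (simp add: N_def mult.commute[of n] power_mult)
    qed
  qed
  \<comment> \<open>The new letter is the conjugate of \<open>a\<close> by the inverse of
    \<open>z\<close>; \<open>S\<close> is closed under conjugation.\<close>
  have S_shift: "\<exists>b\<in>S. a * z = z * b" if a: "a \<in> S" and z: "z \<in> S" for a z
  proof -
    obtain v where v: "inverse_pair z v"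
      using torsion_inverse_pair[OF _ S_pow[OF z] N] z S_R by blast
    then have "inverse_pair v z" by (auto simp: inverse_pair_def)
    then have "v * a * z \<in> S" using S_conj[OF a] by (auto simp: conjugates_def)
    moreover have "z * (v * a * z) = (z * v) * (a * z)" by (simp only: mult.assoc)
    then have "z * (v * a * z) = a * z" using v a z S_R by (simp add: inverse_pair_def e_left R_closed subset_iff)
    ultimately show ?thesis by metis
  qed
  \<comment> \<open>The factor \<open>e\<close> makes the empty word stand for the identity of
    \<open>R\<close> rather than for \<open>1\<close>.\<close>
  define W where "W ws = prod_list ws * e" for ws :: "'a list"
  have W_R: "W ws \<in> R" if "set ws \<subseteq> S" for ws
    using that S_R by (induction ws) (auto simp: W_def e_in mult.assoc intro!: R_closed)
  define M where "M = W ` {ws. set ws \<subseteq> S}"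
  \<comment> \<open>A longer word contains some letter \<open>z\<close> at least \<open>N\<close>
    times; \<open>N\<close> copies collected in front give \<open>z ^ N = e\<close>, so a word
    shorter by \<open>N\<close> has the same value.\<close>
  define L where "L = card S * N"
  have short: "\<exists>vs. set vs \<subseteq> S \<and> length vs \<le> L \<and> W vs = W ws" if "set ws \<subseteq> S" for ws
    using that
  proof (induction "length ws" arbitrary: ws rule: less_induct)
    case less
    show ?case
    proof (cases "length ws \<le> L")
      case False
      have "\<exists>z\<in>S. N \<le> count_list ws z"
      proof (rule ccontr)
        assume "\<not> ?thesis"
        then have "(\<Sum>z\<in>S. count_list ws z) \<le> (\<Sum>z\<in>S. N)" by (intro sum_mono) (meson le_cases)
        then show False using False sum_count_set[OF less.prems fin_S] by (simp add: L_def)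
      qed
      then obtain z where z: "z \<in> S" "N \<le> count_list ws z" by blast
      from collect_factors[OF S_shift[OF _ z(1)] less.prems z(2)]
      obtain vs where vs: "set vs \<subseteq> S" "length vs + N = length ws" "prod_list ws = z ^ N * prod_list vs"
        by blast
      have "W ws = e * W vs" by (simp add: W_def vs(3) S_pow[OF z(1)] mult.assoc)
      then have "W ws = W vs" using e_left[OF W_R[OF vs(1)]] by simp
      then show ?thesis using less.hyps[of vs] vs N by auto
    qed (use less.prems in blast)
  qed
  then have "M \<subseteq> W ` {ws. set ws \<subseteq> S \<and> length ws \<le> L}" unfolding M_def by (auto simp: image_iff) metis
  then have fin_M: "finite M"
    by (rule finite_subset) (intro finite_imageI finite_lists_length_le fin_S)
  have M_closed: "a * b \<in> M" if ab: "a \<in> M" "b \<in> M" for a b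
  proof -
    obtain us vs where *: "set us \<subseteq> S" "set vs \<subseteq> S" "a = W us" "b = W vs" using ab by (auto simp: M_def)
    have "a * b = prod_list us * (e * W vs)" by (simp only: * W_def mult.assoc)
    also have "\<dots> = W (us @ vs)" using e_left[OF W_R[OF *(2)]] by (simp add: W_def mult.assoc)
    finally show ?thesis using * by (auto simp: M_def)
  qed
  have S_M: "S \<subseteq> M"
  proof
    fix z assume "z \<in> S"
    moreover from this have "z = W [z]" using S_R by (simp add: W_def e_right subset_iff)
    ultimately show "z \<in> M" unfolding M_def by (intro image_eqI[of _ _ "[z]"]) auto
  qed
  define A where "A = additive_span M"
  have p_pos: "p > 0" using p(1) prime_gt_0_nat by blast
  have fin_A: "finite A" unfolding A_def by (rule finite_additive_span[OF fin_M p(2) p_pos])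
  have sub_A: "subrng A" unfolding A_def by (rule subrng_additive_span[OF p(2) p_pos M_closed])
  have S_A: "S \<subseteq> A" using S_M additive_span_base by (auto simp: A_def)
  have A_R: "a \<in> R" if "a \<in> A" for a
    using that unfolding A_def
  proof induction
    case (add a m)
    then have "m \<in> R" using W_R by (auto simp: M_def)
    with add.IH show ?case by (rule R_closed(5))
  qed (rule R_closed(1))
  have comm_A: "c * a = a * c" if c: "c \<in> R" "\<And>z. z \<in> S \<Longrightarrow> c * z = z * c" and a: "a \<in> A" for c a
  proof -
    have "c * W ws = W ws * c" if "set ws \<subseteq> S" for ws
      using that
    proof (induction ws)
      case (Cons z ws)
      have "c * W (z # ws) = (c * z) * W ws" by (simp add: W_def mult.assoc)
      also have "\<dots> = z * (c * W ws)" using c(2) Cons.prems by (simp add: mult.assoc)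
      also have "\<dots> = W (z # ws) * c" using Cons by (simp add: W_def mult.assoc)
      finally show ?case .
    qed (use c in \<open>simp add: W_def e_left e_right\<close>)
    with a show ?thesis unfolding A_def
      by induction (auto simp: M_def algebra_simps)
  qed
  have tau_R: "\<tau> i \<in> R" if "i \<in> I" for i using unit[OF that] by (auto simp: inverse_pair_def)
  have tau_A: "\<tau> i * a = a * \<tau> i" if "i \<in> I" "a \<in> A" for i a
    using comm_A[OF tau_R[OF that(1)] _ that(2)] comm[OF that(1)] by (simp add: S_def)
  have split: "\<exists>t\<in>R. a * z = t * a \<and> b * z = t * b"
    if ab: "a \<in> R" "b \<in> R" and u: "\<And>i. i \<in> I \<Longrightarrow> \<exists>v. inverse_pair (b + \<tau> i * a) v" and z: "z \<in> S" for a b z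
  proof -
    have zR: "z \<in> R" using z S_R by blast
    have fin: "finite (conjugates z)" using S_conj[OF z] fin_S by (rule finite_subset)
    have cm: "\<tau> i * t = t * \<tau> i" if "i \<in> I" "t \<in> conjugates z" for i t
      using comm that S_conj[OF z] by (auto simp: S_def)
    obtain t where "t \<in> R" "a * z = t * a" "b * z = t * b"
      by (rule conjugation_splits[OF zR ab fin I u cm separate])
    then show ?thesis by blast
  qed
  have "commutative_on A"
  proof (rule finite_ring_commutative[OF p fin_A sub_A])
    fix a b k assume a: "a \<in> A" "a ^ k = 0" and b: "b \<in> A"
    have aR: "a \<in> R" by (rule A_R[OF a(1)])
    show "a * b = b * a"
    proof (rule comm_A[OF aR _ b])
      fix z assume z: "z \<in> S"
      have "\<exists>v. inverse_pair (e + \<tau> i * a) v" if i: "i \<in> I" for i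
      proof -
        define T where "T = - (\<tau> i * a)"
        \<comment> \<open>The geometric series inverts \<open>e - T\<close>, since \<open>T\<close>
          is nilpotent; the factor \<open>e\<close> keeps the term \<open>j = 0\<close> in
          \<open>R\<close>.\<close>
        define v where "v = (\<Sum>j<k. e * T ^ j)"
        have TR: "T \<in> R" unfolding T_def by (intro R_closed tau_R i aR)
        have "(\<tau> i * a) ^ k = 0" using power_mult_distrib_commuting[OF tau_A[OF i a(1)], of k] a(2) by simp
        then have Tk: "T ^ k = 0" by (simp add: T_def power_minus[of "\<tau> i * a"])
        have v: "v \<in> R" unfolding v_def by (intro subrng_sum subrng_mult_power subrng_R e_in TR)
        have v': "v = e * (\<Sum>j<k. T ^ j)" by (simp add: v_def sum_distrib_left)
        have comm1: "(1 - T) * e = e * (1 - T)" using TR by (simp add: algebra_simps e_left e_right)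
        have "(e - T) * v = (1 - T) * e * (\<Sum>j<k. T ^ j)"
          using v e_left[OF v] by (simp add: left_diff_distrib v' mult.assoc)
        also have "\<dots> = e * ((1 - T) * (\<Sum>j<k. T ^ j))" by (simp only: comm1 mult.assoc)
        finally have 1: "(e - T) * v = e" by (simp add: geometric_sum_ring Tk)
        have "v * (e - T) = e * ((\<Sum>j<k. T ^ j) * (1 - T))"
          using e_right[OF v] by (simp add: right_diff_distrib v' mult.assoc)
        then have 2: "v * (e - T) = e" by (simp add: geometric_sum_ring Tk)
        have "inverse_pair (e - T) v"
          unfolding inverse_pair_def using 1 2 v TR e_in R_closed(2) by blast
        then show ?thesis by (auto simp: T_def)
      qed
      \<comment> \<open>The relation for \<open>e\<close> identifies \<open>t\<close> with
        \<open>z\<close>, so the relation for \<open>a\<close> is the desired commutation.\<close>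
      from split[OF aR e_in this z] obtain t where "t \<in> R" "a * z = t * a" "e * z = t * e" by blast
      then show "a * z = z * a" using z S_R by (auto simp: e_left e_right subset_iff)
    qed
  next
    fix a b assume a: "a \<in> A" "a * a = a" and b: "b \<in> A"
    have aR: "a \<in> R" by (rule A_R[OF a(1)])
    have cR: "e - a \<in> R" by (rule R_closed(2)[OF e_in aR])
    show "a * b = b * a"
    proof (rule comm_A[OF aR _ b])
      fix z assume z: "z \<in> S"
      have "\<exists>v. inverse_pair (e - a + \<tau> i * a) v" if i: "i \<in> I" for i
      proof -
        obtain v where v: "inverse_pair (\<tau> i) v" using unit[OF i] by blast
        have ca: "\<tau> i * a = a * \<tau> i" by (rule tau_A[OF i a(1)])
        have cv: "v * a = a * v" by (rule inverse_pair_commute[OF v aR ca])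
        \<comment> \<open>Since \<open>e - a\<close> and \<open>a\<close> are orthogonal
          idempotents, the product is computed separately on the two components. General
          \<open>s\<close> and \<open>t\<close> cover both orders of multiplication.\<close>
        have prod: "(e - a + s * a) * (e - a + t * a) = e"
          if st: "s \<in> R" "t \<in> R" "s * t = e" "t * a = a * t" for s t
        proof -
          have "s * a * (t * a) = (s * t) * (a * a)" using st(4) by (metis mult.assoc)
          then have "s * a * (t * a) = a" using st a(2) aR by (simp add: e_left)
          moreover have "a * (t * a) = t * a" using st(4) a(2) by (metis mult.assoc)
          moreover have "s * a * a = s * a" by (simp add: mult.assoc a(2))
          moreover have "e * (t * a) = t * a" by (intro e_left R_closed st(2) aR)
          moreover have "s * a * e = s * a" by (intro e_right R_closed st(1) aR)
          ultimately show ?thesis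
            using aR a(2) e_left[OF e_in] by (simp add: algebra_simps e_left e_right)
        qed
        have tv: "\<tau> i \<in> R" "v \<in> R" "\<tau> i * v = e" "v * \<tau> i = e"
          using v by (simp_all add: inverse_pair_def)
        have "inverse_pair (e - a + \<tau> i * a) (e - a + v * a)"
          unfolding inverse_pair_def
          by (intro conjI prod tv cv ca R_closed(5) R_closed(3) cR aR)
        then show ?thesis by blast
      qed
      from split[OF aR cR this z] obtain t where t: "t \<in> R" "a * z = t * a" "(e - a) * z = t * (e - a)"
        by blast
      have "z \<in> R" using z S_R by blast
      \<comment> \<open>The sum of the relations for \<open>a\<close> and
        \<open>e - a\<close>.\<close>
      then have "z = t" using t by (simp add: algebra_simps e_left e_right)
      then show "a * z = z * a" using t(2) by simp
    qed
  qed
  moreover have "x \<in> A" "y \<in> A"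
    using S_A conjugates_refl x(1) y(1) by (auto simp: S_def)
  ultimately show ?thesis by (simp add: commutative_on_def)
qed

end

section \<open>The twisted group algebra as a ring of operators\<close>

text \<open>Operators on all functions form a \<open>ring_1\<close> type whatever the group, so the
  ring laws hold without carrier conditions. Additivity of the left factor makes composition
  distribute over sums in the right factor.\<close>

typedef (overloaded) ('g, 'k::field) additive_operator =
  "{f :: ('g \<Rightarrow> 'k) \<Rightarrow> 'g \<Rightarrow> 'k. \<forall>a b. f (\<lambda>x. a x + b x) = (\<lambda>x. f a x + f b x)}"
  by (rule exI[of _ id]) simp

setup_lifting type_definition_additive_operator

instantiation additive_operator :: (type, field) ring_1
begin

lift_definition zero_additive_operator :: "('a, 'b) additive_operator" is "\<lambda>_ _. 0" by simp
lift_definition one_additive_operator :: "('a, 'b) additive_operator" is "\<lambda>f. f" by simp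
lift_definition plus_additive_operator ::
  "('a, 'b) additive_operator \<Rightarrow> ('a, 'b) additive_operator \<Rightarrow> ('a, 'b) additive_operator"
  is "\<lambda>f g a x. f a x + g a x" by (simp add: algebra_simps)
lift_definition minus_additive_operator ::
  "('a, 'b) additive_operator \<Rightarrow> ('a, 'b) additive_operator \<Rightarrow> ('a, 'b) additive_operator"
  is "\<lambda>f g a x. f a x - g a x" by (simp add: algebra_simps)
lift_definition uminus_additive_operator :: "('a, 'b) additive_operator \<Rightarrow> ('a, 'b) additive_operator"
  is "\<lambda>f a x. - f a x" by (simp add: algebra_simps)
lift_definition times_additive_operator ::
  "('a, 'b) additive_operator \<Rightarrow> ('a, 'b) additive_operator \<Rightarrow> ('a, 'b) additive_operator"
  is "\<lambda>f g a. f (g a)" by simp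

instance
proof
  show "(0 :: ('a, 'b) additive_operator) \<noteq> 1"
  proof
    assume "(0 :: ('a, 'b) additive_operator) = 1"
    then have "(\<lambda>_ _. 0) = (\<lambda>f :: 'a \<Rightarrow> 'b. f)" by transfer
    from fun_cong[OF fun_cong[OF this], of "\<lambda>_. 1" undefined] show False by simp
  qed
qed (transfer; simp add: fun_eq_iff algebra_simps)+

end

lift_definition scalar_operator :: "'k::field \<Rightarrow> ('g, 'k) additive_operator" is "\<lambda>c f x. c * f x"
  by (simp add: algebra_simps)

lemma scalar_operator_hom:
  "scalar_operator (c + d) = scalar_operator c + scalar_operator d"
  "scalar_operator (c * d) = scalar_operator c * scalar_operator d"
  "scalar_operator 1 = 1" "scalar_operator 0 = 0"
  by (transfer; simp add: algebra_simps)+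

lemma of_nat_operator: "of_nat n = scalar_operator (of_nat n)"
  by (induction n) (simp_all add: scalar_operator_hom)

text \<open>
  The results on subsets of a \<open>ring_1\<close> type are transferred to the algebra through its left regular
  action. This action extends from finitely supported functions to all functions, and is cut off
  outside \<open>carrier G\<close>, so that the identity of the algebra acts as a projection rather than as \<open>1\<close>.
\<close>

lift_definition left_mult :: "('g, 'm) monoid_scheme \<Rightarrow> ('g \<Rightarrow> 'g \<Rightarrow> 'k::field) \<Rightarrow> ('g \<Rightarrow> 'k)
    \<Rightarrow> ('g, 'k) additive_operator"
  is "\<lambda>G lam a f x. if x \<in> carrier G
    then \<Sum>g\<in>coeff_support a. a g * lam g (inv\<^bsub>G\<^esub> g \<otimes>\<^bsub>G\<^esub> x) * f (inv\<^bsub>G\<^esub> g \<otimes>\<^bsub>G\<^esub> x) else 0"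
  by (auto simp: fun_eq_iff algebra_simps sum.distrib)

locale twisted = group G for G :: "('g, 'm) monoid_scheme" (structure) +
  fixes lam :: "'g \<Rightarrow> 'g \<Rightarrow> 'k::field"
  assumes cocycle: "two_cocycle G lam"
begin

abbreviation T :: "('k, 'g \<Rightarrow> 'k) module" where "T \<equiv> twisted_group_algebra G lam"
abbreviation L :: "('g \<Rightarrow> 'k) \<Rightarrow> ('g, 'k) additive_operator" where "L \<equiv> left_mult G lam"

sublocale T: ring T
  by (rule tga_ring[OF is_group cocycle])

lemma lam_nonzero: "g \<in> carrier G \<Longrightarrow> h \<in> carrier G \<Longrightarrow> lam g h \<noteq> 0"
  using cocycle by (auto simp: two_cocycle_def)

lemma cocycle_eq:
  "g \<in> carrier G \<Longrightarrow> h \<in> carrier G \<Longrightarrow> k \<in> carrier G \<Longrightarrow>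
    lam g h * lam (g \<otimes> h) k = lam h k * lam g (h \<otimes> k)"
  using cocycle by (simp add: two_cocycle_def)

lemma carrier_T: "a \<in> carrier T \<longleftrightarrow> finite (coeff_support a) \<and> coeff_support a \<subseteq> carrier G"
  by (simp add: twisted_group_algebra_def)

lemma left_mult_superset:
  assumes "finite A" "coeff_support a \<subseteq> A" "x \<in> carrier G"
  shows "Rep_additive_operator (L a) f x
    = (\<Sum>g\<in>A. a g * lam g (inv g \<otimes> x) * f (inv g \<otimes> x))"
proof -
  have "(\<Sum>g\<in>A. a g * lam g (inv g \<otimes> x) * f (inv g \<otimes> x))
      = (\<Sum>g\<in>coeff_support a. a g * lam g (inv g \<otimes> x) * f (inv g \<otimes> x))"
    by (rule sum.mono_neutral_right[OF assms(1,2)]) (auto simp: coeff_support_def)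
  then show ?thesis using assms(3) by (simp add: left_mult.rep_eq)
qed

lemma operator_eqI:
  assumes "\<And>f x. Rep_additive_operator S f x = Rep_additive_operator S' f x"
  shows "S = S'"
  using assms by (simp add: Rep_additive_operator_inject[symmetric] fun_eq_iff)

lemma left_mult_outside: "x \<notin> carrier G \<Longrightarrow> Rep_additive_operator (L a) f x = 0"
  by (simp add: left_mult.rep_eq)

lemma left_mult_add:
  assumes "a \<in> carrier T" "b \<in> carrier T"
  shows "L (a \<oplus>\<^bsub>T\<^esub> b) = L a + L b"
proof (rule operator_eqI)
  fix f x
  let ?A = "coeff_support a \<union> coeff_support b"
  have A: "finite ?A" using assms by (simp add: carrier_T)
  have ab: "a \<oplus>\<^bsub>T\<^esub> b = (\<lambda>x. a x + b x)" by (simp add: twisted_group_algebra_def)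
  have "coeff_support (a \<oplus>\<^bsub>T\<^esub> b) \<subseteq> ?A" by (auto simp: ab coeff_support_def)
  then show "Rep_additive_operator (L (a \<oplus>\<^bsub>T\<^esub> b)) f x = Rep_additive_operator (L a + L b) f x"
    by (cases "x \<in> carrier G")
       (simp_all add: plus_additive_operator.rep_eq left_mult_outside left_mult_superset[OF A]
         ab algebra_simps sum.distrib)
qed

lemma left_mult_mult:
  assumes a: "a \<in> carrier T" and b: "b \<in> carrier T"
  shows "L (a \<otimes>\<^bsub>T\<^esub> b) = L a * L b"
proof (rule operator_eqI)
  fix f x
  let ?A = "coeff_support a" and ?B = "coeff_support b"
  let ?D = "(\<lambda>(g, h). g \<otimes> h) ` (?A \<times> ?B)"
  let ?R = "Rep_additive_operator"
  have fin: "finite ?A" "finite ?B" "finite ?D" and sub: "?A \<subseteq> carrier G" "?B \<subseteq> carrier G"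
    using a b by (auto simp: carrier_T)
  show "?R (L (a \<otimes>\<^bsub>T\<^esub> b)) f x = ?R (L a * L b) f x"
  proof (cases "x \<in> carrier G")
    case x: True
    have ab: "(a \<otimes>\<^bsub>T\<^esub> b) k = (\<Sum>g\<in>?A. \<Sum>h\<in>?B. if g \<otimes> h = k then a g * b h * lam g h else 0)" for k
      by (simp add: twisted_group_algebra_def)
    define F where "F k = lam k (inv k \<otimes> x) * f (inv k \<otimes> x)" for k
    have "?R (L (a \<otimes>\<^bsub>T\<^esub> b)) f x = (\<Sum>k\<in>?D. (a \<otimes>\<^bsub>T\<^esub> b) k * F k)"
      unfolding left_mult_superset[OF fin(3) tga_mult_support x] F_def by (simp add: mult.assoc)
    also have "\<dots> = (\<Sum>k\<in>?D. \<Sum>g\<in>?A. \<Sum>h\<in>?B. if g \<otimes> h = k then a g * b h * lam g h * F k else 0)"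
      unfolding ab sum_distrib_right by (intro sum.cong refl) simp
    also have "\<dots> = (\<Sum>g\<in>?A. \<Sum>h\<in>?B. \<Sum>k\<in>?D. if g \<otimes> h = k then a g * b h * lam g h * F k else 0)"
      by (rule sum_move_inside2)
    also have "\<dots> = (\<Sum>g\<in>?A. \<Sum>h\<in>?B. a g * b h * lam g h * F (g \<otimes> h))"
      using fin by (intro sum.cong refl) (simp add: sum.delta', force)
    also have "\<dots> = (\<Sum>g\<in>?A. \<Sum>h\<in>?B. a g * lam g (inv g \<otimes> x) *
        (b h * lam h (inv h \<otimes> (inv g \<otimes> x)) * f (inv h \<otimes> (inv g \<otimes> x))))"
    proof (intro sum.cong refl)
      fix g h assume "g \<in> ?A" "h \<in> ?B"
      then have gh: "g \<in> carrier G" "h \<in> carrier G" using sub by auto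
      let ?y = "inv h \<otimes> (inv g \<otimes> x)"
      have y: "?y \<in> carrier G" "inv (g \<otimes> h) \<otimes> x = ?y"
        using gh x by (simp_all add: inv_mult_group m_assoc)
      have y': "h \<otimes> ?y = inv g \<otimes> x" using gh x by (simp flip: m_assoc)
      \<comment> \<open>Here \<open>g \<otimes> h \<otimes> ?y = x\<close>: the cocycle identity
        says that acting by the product and acting twice give the same scalar.\<close>
      have "lam g h * lam (g \<otimes> h) ?y = lam h ?y * lam g (h \<otimes> ?y)"
        by (rule cocycle_eq[OF gh y(1)])
      then have lam_eq: "lam g h * lam (g \<otimes> h) ?y = lam h ?y * lam g (inv g \<otimes> x)"
        by (simp only: y')
      have "a g * b h * lam g h * F (g \<otimes> h) = a g * b h * (lam g h * lam (g \<otimes> h) ?y) * f ?y"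
        unfolding F_def y(2) by (simp only: mult.assoc)
      then show "a g * b h * lam g h * F (g \<otimes> h)
          = a g * lam g (inv g \<otimes> x) * (b h * lam h ?y * f ?y)"
        unfolding lam_eq by (simp only: mult_ac)
    qed
    also have "\<dots> = (\<Sum>g\<in>?A. a g * lam g (inv g \<otimes> x) * ?R (L b) f (inv g \<otimes> x))"
    proof (intro sum.cong refl)
      fix g assume "g \<in> ?A"
      then have "inv g \<otimes> x \<in> carrier G" using sub x by auto
      from left_mult_superset[OF fin(2) subset_refl this]
      show "(\<Sum>h\<in>?B. a g * lam g (inv g \<otimes> x) *
          (b h * lam h (inv h \<otimes> (inv g \<otimes> x)) * f (inv h \<otimes> (inv g \<otimes> x))))
        = a g * lam g (inv g \<otimes> x) * ?R (L b) f (inv g \<otimes> x)"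
        by (simp only: sum_distrib_left)
    qed
    also have "\<dots> = ?R (L a) (?R (L b) f) x"
      by (rule left_mult_superset[OF fin(1) subset_refl x, symmetric])
    finally show ?thesis by (simp add: times_additive_operator.rep_eq)
  qed (simp add: times_additive_operator.rep_eq left_mult_outside)
qed

text \<open>Applied to \<open>basis_unit \<one>\<close>, the operator returns each coefficient times
  a nonzero cocycle value, so the coefficients can be recovered.\<close>

lemma left_mult_inj:
  assumes "a \<in> carrier T" "b \<in> carrier T" "L a = L b"
  shows "a = b"
proof
  fix x
  have coeff_from_value: "Rep_additive_operator (L c) (basis_unit \<one>) x = c x * lam x \<one>"
    if c: "c \<in> carrier T" and x: "x \<in> carrier G" for c
  proof -
    have fin: "finite (coeff_support c)" and sub: "coeff_support c \<subseteq> carrier G"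
      using c by (auto simp: carrier_T)
    have "Rep_additive_operator (L c) (basis_unit \<one>) x
        = (\<Sum>g\<in>coeff_support c. c g * lam g (inv g \<otimes> x) * basis_unit \<one> (inv g \<otimes> x))"
      by (rule left_mult_superset[OF fin subset_refl x])
    also have "\<dots> = (\<Sum>g\<in>coeff_support c. if g = x then c x * lam x \<one> else 0)"
    proof (intro sum.cong refl)
      fix g assume "g \<in> coeff_support c"
      then have g: "g \<in> carrier G" using sub by blast
      have "inv g \<otimes> x = \<one> \<longleftrightarrow> g = x"
        using g x by (metis inv_closed inv_equality inv_inv l_inv)
      then show "c g * lam g (inv g \<otimes> x) * basis_unit \<one> (inv g \<otimes> x) = (if g = x then c x * lam x \<one> else 0)"
        using x by (auto simp: basis_unit_def)
    qed
    also have "\<dots> = c x * lam x \<one>" using fin by (simp add: sum.delta) (simp add: coeff_support_def)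
    finally show ?thesis .
  qed
  show "a x = b x"
  proof (cases "x \<in> carrier G")
    case True
    then show ?thesis using coeff_from_value[OF assms(1)] coeff_from_value[OF assms(2)] assms(3) lam_nonzero[OF True] by simp
  next
    case False
    then have "x \<notin> coeff_support a" "x \<notin> coeff_support b" using assms by (auto simp: carrier_T)
    then show ?thesis by (simp add: coeff_support_def)
  qed
qed

section \<open>Transfer of units, conjugates and powers to operators\<close>

definition R :: "('g, 'k) additive_operator set" where "R = L ` carrier T"
definition one_op :: "('g, 'k) additive_operator" where "one_op = L \<one>\<^bsub>T\<^esub>"

lemma R_I: "a \<in> carrier T \<Longrightarrow> L a \<in> R"
  by (simp add: R_def)

lemma R_E:
  assumes "S \<in> R"
  obtains a where "a \<in> carrier T" "S = L a"
  using assms by (auto simp: R_def)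

sublocale unital_subrng R one_op
proof
  have zero: "L \<zero>\<^bsub>T\<^esub> = 0"
    using left_mult_add[of "\<zero>\<^bsub>T\<^esub>" "\<zero>\<^bsub>T\<^esub>"] by simp
  have diff: "L (a \<ominus>\<^bsub>T\<^esub> b) = L a - L b" if "a \<in> carrier T" "b \<in> carrier T" for a b
  proof -
    have "(a \<ominus>\<^bsub>T\<^esub> b) \<oplus>\<^bsub>T\<^esub> b = a" using that by algebra
    then show ?thesis using left_mult_add[of "a \<ominus>\<^bsub>T\<^esub> b" b] that by (simp add: eq_diff_eq)
  qed
  show "subrng R" unfolding subrng_def
  proof (intro conjI ballI)
    show "0 \<in> R" using R_I[OF T.zero_closed] zero by simp
    fix S S' assume "S \<in> R" "S' \<in> R"
    then obtain a b where ab: "a \<in> carrier T" "b \<in> carrier T" "S = L a" "S' = L b" by (metis R_E)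
    show "S - S' \<in> R" using R_I[OF T.minus_closed] ab diff by metis
    show "S * S' \<in> R" using R_I[OF T.m_closed] ab left_mult_mult by metis
  qed
  show "one_op \<in> R" by (simp add: one_op_def R_I)
  fix S assume "S \<in> R"
  then obtain a where a: "a \<in> carrier T" "S = L a" by (rule R_E)
  show "one_op * S = S" "S * one_op = S"
    using a left_mult_mult[of "\<one>\<^bsub>T\<^esub>" a] left_mult_mult[of a "\<one>\<^bsub>T\<^esub>"] by (simp_all add: one_op_def)
qed

abbreviation UT :: "('g \<Rightarrow> 'k) monoid" where "UT \<equiv> units_of T"

lemma group_U: "group UT"
  by (rule T.units_group)

lemma U_simps: "carrier UT = Units T" "monoid.mult UT = monoid.mult T" "monoid.one UT = monoid.one T"
  by (simp_all add: units_of_def)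

lemma U_carrier: "a \<in> carrier UT \<Longrightarrow> a \<in> carrier T"
  by (simp add: U_simps Units_def)

lemma inverse_pair_iff:
  assumes "w \<in> carrier T" "v \<in> carrier T"
  shows "inverse_pair (L w) (L v) \<longleftrightarrow> w \<in> carrier UT \<and> v = inv\<^bsub>UT\<^esub> w"
proof
  assume "inverse_pair (L w) (L v)"
  then have "L (w \<otimes>\<^bsub>T\<^esub> v) = L \<one>\<^bsub>T\<^esub>" "L (v \<otimes>\<^bsub>T\<^esub> w) = L \<one>\<^bsub>T\<^esub>"
    using assms unfolding inverse_pair_def by (simp_all add: one_op_def left_mult_mult)
  then have wv: "w \<otimes>\<^bsub>T\<^esub> v = \<one>\<^bsub>T\<^esub>" "v \<otimes>\<^bsub>T\<^esub> w = \<one>\<^bsub>T\<^esub>"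
    using assms left_mult_inj by blast+
  then have "w \<in> carrier UT" "v \<in> carrier UT" using assms by (auto simp: U_simps Units_def)
  moreover from this have "inv\<^bsub>UT\<^esub> w = v"
    using group.inv_equality[OF group_U, of v w] wv by (simp add: U_simps)
  ultimately show "w \<in> carrier UT \<and> v = inv\<^bsub>UT\<^esub> w" by simp
next
  assume *: "w \<in> carrier UT \<and> v = inv\<^bsub>UT\<^esub> w"
  then have "w \<otimes>\<^bsub>UT\<^esub> v = \<one>\<^bsub>UT\<^esub>" "v \<otimes>\<^bsub>UT\<^esub> w = \<one>\<^bsub>UT\<^esub>"
    using group.r_inv[OF group_U] group.l_inv[OF group_U] by auto
  then show "inverse_pair (L w) (L v)"
    using assms unfolding inverse_pair_def by (simp add: one_op_def U_simps R_I flip: left_mult_mult)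
qed

lemma finite_conjugates:
  assumes "x \<in> FC_center UT"
  shows "finite (conjugates (L x))"
proof -
  have x: "x \<in> carrier UT" and fin: "finite {g \<otimes>\<^bsub>UT\<^esub> x \<otimes>\<^bsub>UT\<^esub> inv\<^bsub>UT\<^esub> g | g. g \<in> carrier UT}"
    using assms unfolding FC_center_def by blast+
  have "conjugates (L x) \<subseteq> L ` {g \<otimes>\<^bsub>UT\<^esub> x \<otimes>\<^bsub>UT\<^esub> inv\<^bsub>UT\<^esub> g | g. g \<in> carrier UT}"
  proof
    fix S assume "S \<in> conjugates (L x)"
    then obtain W V where WV: "S = W * L x * V" "inverse_pair W V" by (auto simp: conjugates_def)
    then have "W \<in> R" "V \<in> R" by (simp_all add: inverse_pair_def)
    then obtain w v where wv: "w \<in> carrier T" "v \<in> carrier T" "W = L w" "V = L v"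
      by (metis R_E)
    then have "w \<in> carrier UT" "v = inv\<^bsub>UT\<^esub> w" using WV(2) inverse_pair_iff by auto
    moreover have "S = L (w \<otimes>\<^bsub>UT\<^esub> x \<otimes>\<^bsub>UT\<^esub> v)"
      using WV(1) wv U_carrier[OF x] by (simp add: U_simps left_mult_mult)
    ultimately show "S \<in> L ` {g \<otimes>\<^bsub>UT\<^esub> x \<otimes>\<^bsub>UT\<^esub> inv\<^bsub>UT\<^esub> g | g. g \<in> carrier UT}" by blast
  qed
  then show ?thesis by (rule finite_subset) (use fin in simp)
qed

lemma left_mult_power:
  assumes "x \<in> carrier UT" "n > 0"
  shows "L (x [^]\<^bsub>UT\<^esub> n) = L x ^ n"
  using assms(2)
proof (induction n)
  case (Suc n)
  interpret U: group UT by (rule group_U)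
  show ?case
  proof (cases "n = 0")
    case False
    then have "L (x [^]\<^bsub>UT\<^esub> Suc n) = L (x [^]\<^bsub>UT\<^esub> n) * L x"
      using left_mult_mult[OF U_carrier[OF U.nat_pow_closed[OF assms(1)]] U_carrier[OF assms(1)]]
      by (simp add: U_simps)
    then show ?thesis using Suc False by (simp add: power_Suc2 del: power_Suc)
  qed (use assms in \<open>simp add: U.nat_pow_eone\<close>)
qed simp

lemma scalar_commute: "scalar_operator c * L a = L a * scalar_operator c"
  by (rule operator_eqI)
     (simp add: times_additive_operator.rep_eq scalar_operator.rep_eq left_mult.rep_eq
       sum_distrib_left mult_ac)

lemma scalar_mult_R:
  assumes "a \<in> carrier T"
  shows "scalar_operator c * L a = L (c \<odot>\<^bsub>T\<^esub> a)" and "c \<odot>\<^bsub>T\<^esub> a \<in> carrier T"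
proof -
  have ca: "c \<odot>\<^bsub>T\<^esub> a = (\<lambda>x. c * a x)" by (simp add: twisted_group_algebra_def)
  have sub: "coeff_support (c \<odot>\<^bsub>T\<^esub> a) \<subseteq> coeff_support a" by (auto simp: ca coeff_support_def)
  have fin: "finite (coeff_support a)" using assms by (simp add: carrier_T)
  show "c \<odot>\<^bsub>T\<^esub> a \<in> carrier T" using sub fin assms finite_subset[OF sub fin] by (simp add: carrier_T)
  show "scalar_operator c * L a = L (c \<odot>\<^bsub>T\<^esub> a)"
  proof (rule operator_eqI)
    fix f x
    show "Rep_additive_operator (scalar_operator c * L a) f x = Rep_additive_operator (L (c \<odot>\<^bsub>T\<^esub> a)) f x"
    proof (cases "x \<in> carrier G")
      case True
      show ?thesis
        unfolding times_additive_operator.rep_eq scalar_operator.rep_eq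
          left_mult_superset[OF fin sub True] left_mult_superset[OF fin subset_refl True]
        by (simp add: ca sum_distrib_left mult.assoc)
    qed (simp add: times_additive_operator.rep_eq scalar_operator.rep_eq left_mult_outside)
  qed
qed

lemma basis_unit_T: "g \<in> carrier G \<Longrightarrow> basis_unit g \<in> carrier T"
proof -
  assume "g \<in> carrier G"
  moreover have "coeff_support (basis_unit g :: 'g \<Rightarrow> 'k) = {g}"
    by (auto simp: coeff_support_def basis_unit_def)
  ultimately show ?thesis by (simp add: carrier_T)
qed

text \<open>The basis elements at \<open>g\<close> and \<open>inv g\<close> multiply to a scalar,
  since the one at \<open>\<one>\<close> is \<open>lam \<one> \<one>\<close> times the identity. The
  symmetry \<open>lam g (inv g) = lam (inv g) g\<close>, a case of the cocycle identity, makes the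
  same scalar work on both sides.\<close>

lemma basis_unit_inverse_pair:
  assumes g: "g \<in> carrier G"
  shows "\<exists>V. inverse_pair (L (basis_unit g)) V"
proof -
  have one: "basis_unit \<one> = lam \<one> \<one> \<odot>\<^bsub>T\<^esub> \<one>\<^bsub>T\<^esub>"
    using lam_nonzero[of \<one> \<one>] by (auto simp: twisted_group_algebra_def basis_unit_def fun_eq_iff)
  have prod: "L (basis_unit h) * L (basis_unit k) = scalar_operator (lam h k * lam \<one> \<one>) * one_op"
    if "h \<in> carrier G" "k \<in> carrier G" "h \<otimes> k = \<one>" for h k
  proof -
    have "L (basis_unit h) * L (basis_unit k) = L (lam h k \<odot>\<^bsub>T\<^esub> basis_unit \<one>)"
      using that basis_unit_T by (simp add: tga_basis_mult flip: left_mult_mult)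
    also have "\<dots> = scalar_operator (lam h k) * (scalar_operator (lam \<one> \<one>) * one_op)"
      by (simp add: scalar_mult_R(1)[symmetric] basis_unit_T one_op_def one scalar_mult_R(2))
    finally show ?thesis by (simp add: scalar_operator_hom mult.assoc)
  qed
  let ?h = "inv g"
  have h: "?h \<in> carrier G" using g by simp
  have eq: "lam g ?h = lam ?h g"
  proof -
    have "lam g ?h * lam (g \<otimes> ?h) g = lam ?h g * lam g (?h \<otimes> g)"
      by (rule cocycle_eq[OF g h g])
    then show ?thesis
      using g two_cocycle_one[OF is_group cocycle g] lam_nonzero[of \<one> \<one>] by simp
  qed
  define c where "c = lam g ?h * lam \<one> \<one>"
  have "c \<noteq> 0" using lam_nonzero[OF g h] lam_nonzero[of \<one> \<one>] by (simp add: c_def)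
  then have c: "inverse c * c = 1" by (rule left_inverse)
  define V where "V = scalar_operator (inverse c) * L (basis_unit ?h)"
  have scal: "scalar_operator (inverse c) * (scalar_operator c * one_op) = one_op"
  proof -
    have "scalar_operator (inverse c) * (scalar_operator c * one_op) = scalar_operator (inverse c * c) * one_op"
      by (simp only: scalar_operator_hom(2) mult.assoc)
    then show ?thesis by (simp add: c scalar_operator_hom(3))
  qed
  have "V \<in> R" unfolding V_def scalar_mult_R(1)[OF basis_unit_T[OF h]]
    by (rule R_I[OF scalar_mult_R(2)[OF basis_unit_T[OF h]]])
  moreover have "L (basis_unit g) * V = one_op"
  proof -
    have "L (basis_unit g) * V = scalar_operator (inverse c) * (L (basis_unit g) * L (basis_unit ?h))"
      unfolding V_def mult.assoc[symmetric] scalar_commute[of "inverse c" "basis_unit g"] ..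
    then show ?thesis using prod[OF g h] g scal by (simp add: c_def)
  qed
  moreover have "V * L (basis_unit g) = one_op"
    unfolding V_def mult.assoc prod[OF h g l_inv[OF g]] using scal by (simp add: c_def eq)
  ultimately show ?thesis using R_I[OF basis_unit_T[OF g]] by (auto simp: inverse_pair_def)
qed

text \<open>For \<open>h\<close> in the support of \<open>v\<close>, each such \<open>g\<close> puts
  \<open>g \<otimes> h\<close> into the finite support of \<open>w\<close>, and different
  \<open>g\<close> give different elements.\<close>

lemma basis_translates_separate:
  assumes "v \<in> carrier T" "w \<in> carrier T" "infinite {g \<in> carrier G. basis_unit g \<otimes>\<^bsub>T\<^esub> v = w}"
  shows "v = \<zero>\<^bsub>T\<^esub>"
proof (rule ccontr)
  assume "v \<noteq> \<zero>\<^bsub>T\<^esub>"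
  then obtain h where h: "h \<in> coeff_support v"
    by (auto simp: twisted_group_algebra_def coeff_support_def fun_eq_iff)
  have v: "finite (coeff_support v)" "coeff_support v \<subseteq> carrier G" using assms(1) by (auto simp: carrier_T)
  with h have hG: "h \<in> carrier G" by blast
  let ?J = "{g \<in> carrier G. basis_unit g \<otimes>\<^bsub>T\<^esub> v = w}"
  have "(\<lambda>g. g \<otimes> h) ` ?J \<subseteq> coeff_support w"
  proof (clarify)
    fix g assume g: "g \<in> carrier G"
    have "(basis_unit g \<otimes>\<^bsub>T\<^esub> v) (g \<otimes> h)
        = (\<Sum>g'\<in>{g}. \<Sum>k\<in>coeff_support v. if g' \<otimes> k = g \<otimes> h then basis_unit g g' * v k * lam g' k else 0)"
      by (rule tga_mult_superset) (use v in \<open>auto simp: coeff_support_def basis_unit_def\<close>)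
    also have "\<dots> = (\<Sum>k\<in>coeff_support v. if k = h then v h * lam g h else 0)"
      using v(2) hG g by (auto simp: basis_unit_def intro!: sum.cong)
    also have "\<dots> = v h * lam g h" using v(1) h by (simp add: sum.delta)
    also have "\<dots> \<noteq> 0" using h lam_nonzero[OF g hG] by (simp add: coeff_support_def)
    finally show "g \<otimes> h \<in> coeff_support (basis_unit g \<otimes>\<^bsub>T\<^esub> v)" by (simp add: coeff_support_def)
  qed
  moreover have "inj_on (\<lambda>g. g \<otimes> h) ?J"
    by (rule inj_onI) (use hG in \<open>simp add: right_cancel\<close>)
  moreover have "finite (coeff_support w)" using assms(2) by (simp add: carrier_T)
  ultimately show False using assms(3) inj_on_finite by blast
qed

lemma torsion_FC_commute:
  fixes n m :: nat
  assumes "infinite (carrier T)"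
    and x: "x \<in> FC_center UT" "x [^]\<^bsub>UT\<^esub> n = \<one>\<^bsub>UT\<^esub>" "n > 0"
    and y: "y \<in> FC_center UT" "y [^]\<^bsub>UT\<^esub> m = \<one>\<^bsub>UT\<^esub>" "m > 0"
  shows "x \<otimes>\<^bsub>T\<^esub> y = y \<otimes>\<^bsub>T\<^esub> x"
proof -
  have xU: "x \<in> carrier UT" "y \<in> carrier UT" using x y by (auto simp: FC_center_def)
  note xT = U_carrier[OF xU(1)] U_carrier[OF xU(2)]
  note xR = R_I[OF xT(1)] R_I[OF xT(2)]
  note fin = finite_conjugates[OF x(1)] finite_conjugates[OF y(1)]
  have pow: "L x ^ n = one_op" "L y ^ m = one_op"
    using left_mult_power[OF xU(1) x(3)] left_mult_power[OF xU(2) y(3)] x(2) y(2)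
    by (simp_all add: U_simps one_op_def)
  have "L x * L y = L y * L x"
  proof (cases "finite (UNIV :: 'k set)")
    case False
    have comm: "scalar_operator c * one_op * S = S * (scalar_operator c * one_op)" if S: "S \<in> R" for c S
    proof -
      obtain a where "S = L a" using R_E[OF S] by blast
      then show ?thesis using S scalar_commute[of c a] e_left[OF S] e_right[OF S]
        by (metis mult.assoc)
    qed
    show ?thesis
    proof (rule torsion_FC_commute_infinite_field[OF False, of "\<lambda>c. scalar_operator c * one_op"])
      show "scalar_operator c * one_op \<in> R" for c
        unfolding one_op_def using scalar_mult_R[OF T.one_closed] R_I by metis
      show "scalar_operator (c + d) * one_op = scalar_operator c * one_op + scalar_operator d * one_op" for c d
        by (simp add: scalar_operator_hom distrib_right)
      show "scalar_operator (c * d) * one_op = scalar_operator c * one_op * (scalar_operator d * one_op)" for c d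
        using scalar_commute[of d "\<one>\<^bsub>T\<^esub>"] e_left[OF e_in]
        unfolding one_op_def[symmetric] scalar_operator_hom(2) by (metis mult.assoc)
    qed (use comm xR fin pow y(3) in \<open>simp_all add: scalar_operator_hom\<close>)
  next
    case True
    have infG: "infinite (carrier G)"
    proof
      assume finG: "finite (carrier G)"
      have "carrier T \<subseteq> {f. \<forall>g. (g \<in> carrier G \<longrightarrow> f g \<in> UNIV) \<and> (g \<notin> carrier G \<longrightarrow> f g = 0)}"
        by (auto simp: carrier_T coeff_support_def)
      then show False using assms(1) finite_set_of_finite_funs[OF finG True] finite_subset by blast
    qed
    define p where "p = CHAR('k)"
    have p: "Factorial_Ring.prime p" unfolding p_def
      using prime_CHAR_semidom finite_imp_CHAR_pos[OF True] by blast
    have p0: "of_nat p = (0 :: ('g, 'k) additive_operator)"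
      by (simp add: of_nat_operator p_def scalar_operator_hom)
    define S where "S = conjugates (L x) \<union> conjugates (L y)"
    have finS: "finite S" using fin by (simp add: S_def)
    obtain V where V: "\<And>g. g \<in> carrier G \<Longrightarrow> inverse_pair (L (basis_unit g)) (V g)"
      using basis_unit_inverse_pair by metis
    \<comment> \<open>The conjugation action of a basis element on the finite set \<open>S\<close>.
      Infinitely many \<open>g\<close> act like one \<open>k\<close>, and for these
      \<open>?\<tau> g\<close> centralizes \<open>S\<close>.\<close>
    define h where "h g = restrict (\<lambda>z. L (basis_unit g) * z * V g) S" for g
    have "h g \<in> S \<rightarrow>\<^sub>E S" if "g \<in> carrier G" for g
      unfolding h_def restrict_PiE_iff using conjugates_trans[OF _ V[OF that]] by (auto simp: S_def)
    then have "h ` carrier G \<subseteq> S \<rightarrow>\<^sub>E S" by blast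
    then have "finite (h ` carrier G)"
      by (rule finite_subset) (intro finite_PiE finS)
    from pigeonhole_infinite[OF infG this]
    obtain k where k: "k \<in> carrier G" "infinite {g \<in> carrier G. h g = h k}" by blast
    define J where "J = {g \<in> carrier G. h g = h k}"
    let ?\<tau> = "\<lambda>g. V k * L (basis_unit g)"
    have kR: "L (basis_unit k) \<in> R" "V k \<in> R" "L (basis_unit k) * V k = one_op" "V k * L (basis_unit k) = one_op"
      using V[OF k(1)] by (auto simp: inverse_pair_def)
    show ?thesis
    proof (rule torsion_FC_commute_prime_char[OF p p0 xR(1) fin(1) pow(1) x(3) xR(2) fin(2) pow(2) y(3),
        of J ?\<tau>])
      show "infinite J" using k(2) by (simp add: J_def)
      show "\<exists>W. inverse_pair (?\<tau> g) W" if "g \<in> J" for g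
      proof -
        have g: "L (basis_unit g) \<in> R" "V g \<in> R" "L (basis_unit g) * V g = one_op" "V g * L (basis_unit g) = one_op"
          using V[of g] that by (auto simp: inverse_pair_def J_def)
        have "?\<tau> g * (V g * L (basis_unit k)) = V k * (L (basis_unit g) * V g) * L (basis_unit k)"
          "V g * L (basis_unit k) * ?\<tau> g = V g * (L (basis_unit k) * V k) * L (basis_unit g)"
          by (simp_all only: mult.assoc)
        then have "inverse_pair (?\<tau> g) (V g * L (basis_unit k))"
          using g kR by (simp add: inverse_pair_def e_right R_closed(3))
        then show ?thesis by blast
      qed
      show "?\<tau> g * z = z * ?\<tau> g" if g: "g \<in> J" and z: "z \<in> conjugates (L x) \<union> conjugates (L y)" for g z
      proof -
        have zR: "z \<in> R" using z conjugates_R xR by blast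
        have gV: "L (basis_unit g) \<in> R" "V g * L (basis_unit g) = one_op"
          using V[of g] g by (auto simp: inverse_pair_def J_def)
        have "h g z = h k z" using g by (simp add: J_def)
        then have "L (basis_unit g) * z * V g = L (basis_unit k) * z * V k"
          using z by (simp add: h_def S_def)
        then have "V k * (L (basis_unit g) * z * V g) * L (basis_unit g)
            = V k * (L (basis_unit k) * z * V k) * L (basis_unit g)" by simp
        then have "V k * L (basis_unit g) * (z * (V g * L (basis_unit g)))
            = (V k * L (basis_unit k)) * z * (V k * L (basis_unit g))" by (simp only: mult.assoc)
        then show ?thesis using gV kR zR by (simp add: e_left e_right)
      qed
      show "v = 0" if v: "v \<in> R" and w: "w \<in> R" and inf: "infinite {g \<in> J. ?\<tau> g * v = w}" for v w
      proof -
        obtain a where a: "a \<in> carrier T" "v = L a" using v by (rule R_E)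
        have "L (basis_unit k) * w \<in> R" using kR(1) w by (rule R_closed(3))
        then obtain b where b: "b \<in> carrier T" "L (basis_unit k) * w = L b" by (rule R_E)
        \<comment> \<open>Multiplying by the basis element at \<open>k\<close> removes the fixed
          factor \<open>V k\<close> and reduces separation to plain translates.\<close>
        have "basis_unit g \<otimes>\<^bsub>T\<^esub> a = b" if g: "g \<in> J" "?\<tau> g * v = w" for g
        proof -
          have gT: "basis_unit g \<in> carrier T" using g(1) basis_unit_T by (simp add: J_def)
          have "L b = L (basis_unit k) * V k * (L (basis_unit g) * v)"
            using g(2) b(2) by (metis mult.assoc)
          also have "\<dots> = L (basis_unit g) * v"
            unfolding kR(3) by (rule e_left[OF R_closed(3)[OF R_I[OF gT] v]])
          finally have "L (basis_unit g \<otimes>\<^bsub>T\<^esub> a) = L b" using left_mult_mult[OF gT a(1)] a(2) by simp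
          then show ?thesis using left_mult_inj T.m_closed[OF gT a(1)] b(1) by blast
        qed
        then have "{g \<in> J. ?\<tau> g * v = w} \<subseteq> {g \<in> carrier G. basis_unit g \<otimes>\<^bsub>T\<^esub> a = b}"
          by (auto simp: J_def)
        from infinite_super[OF this inf] have "a = \<zero>\<^bsub>T\<^esub>" by (rule basis_translates_separate[OF a(1) b(1)])
        then show "v = 0" using left_mult_add[of "\<zero>\<^bsub>T\<^esub>" "\<zero>\<^bsub>T\<^esub>"] a(2) by simp
      qed
    qed
  qed
  then have "L (x \<otimes>\<^bsub>T\<^esub> y) = L (y \<otimes>\<^bsub>T\<^esub> x)" using xT by (simp add: left_mult_mult)
  then show ?thesis using left_mult_inj T.m_closed xT by blast
qed

end

section \<open>The FC-center and its elements of finite order as groups\<close>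

lemma mem_FC_center:
  "x \<in> FC_center G \<longleftrightarrow> x \<in> carrier G \<and> finite ((\<lambda>g. g \<otimes>\<^bsub>G\<^esub> x \<otimes>\<^bsub>G\<^esub> inv\<^bsub>G\<^esub> g) ` carrier G)"
  unfolding FC_center_def Setcompr_eq_image by blast

lemma (in group) FC_center_subgroup: "subgroup (FC_center G) G"
proof
  let ?c = "\<lambda>x. (\<lambda>g. g \<otimes> x \<otimes> inv g) ` carrier G"
  show "FC_center G \<subseteq> carrier G" by (simp add: mem_FC_center subset_iff)
  have "?c \<one> \<subseteq> {\<one>}" by auto
  then have "finite (?c \<one>)" by (rule finite_subset) simp
  then show "\<one> \<in> FC_center G" by (simp add: mem_FC_center)
  fix x assume x: "x \<in> FC_center G"
  then have xG: "x \<in> carrier G" and fx: "finite (?c x)" by (simp_all add: mem_FC_center)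
  have "g \<otimes> inv x \<otimes> inv g = inv (g \<otimes> x \<otimes> inv g)" if "g \<in> carrier G" for g
    using that xG by (simp add: inv_mult_group m_assoc)
  then have "?c (inv x) \<subseteq> m_inv G ` ?c x" by auto
  then have "finite (?c (inv x))" by (rule finite_subset) (use fx in simp)
  then show "inv x \<in> FC_center G" using xG by (simp add: mem_FC_center)
  fix y assume y: "y \<in> FC_center G"
  then have yG: "y \<in> carrier G" and fy: "finite (?c y)" by (simp_all add: mem_FC_center)
  have "?c (x \<otimes> y) \<subseteq> (\<lambda>(a, b). a \<otimes> b) ` (?c x \<times> ?c y)"
  proof
    fix z assume "z \<in> ?c (x \<otimes> y)"
    then obtain g where g: "g \<in> carrier G" "z = g \<otimes> (x \<otimes> y) \<otimes> inv g" by blast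
    have "(g \<otimes> x \<otimes> inv g) \<otimes> (g \<otimes> y \<otimes> inv g) = g \<otimes> x \<otimes> (inv g \<otimes> g) \<otimes> (y \<otimes> inv g)"
      using g(1) xG yG by (simp only: m_assoc m_closed inv_closed)
    then have "z = (g \<otimes> x \<otimes> inv g) \<otimes> (g \<otimes> y \<otimes> inv g)"
      using g xG yG by (simp add: m_assoc)
    then show "z \<in> (\<lambda>(a, b). a \<otimes> b) ` (?c x \<times> ?c y)" using g(1) by blast
  qed
  then have "finite (?c (x \<otimes> y))" by (rule finite_subset) (use fx fy in simp)
  then show "x \<otimes> y \<in> FC_center G" using xG yG by (simp add: mem_FC_center)
qed

text \<open>Commutation already enters the closure under products: it gives
  \<open>(x \<otimes> y) [^] (n * m) = \<one>\<close>.\<close>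

lemma (in group) comm_group_torsion:
  assumes H: "subgroup H G"
    and comm: "\<And>x y n m. x \<in> H \<Longrightarrow> y \<in> H \<Longrightarrow> x [^] n = \<one> \<Longrightarrow> y [^] m = \<one> \<Longrightarrow> n > (0::nat) \<Longrightarrow> m > (0::nat)
      \<Longrightarrow> x \<otimes> y = y \<otimes> x"
  shows "comm_group (G\<lparr>carrier := finite_order_elements G H\<rparr>)"
proof -
  let ?K = "finite_order_elements G H"
  have mem: "x \<in> ?K \<longleftrightarrow> x \<in> H \<and> (\<exists>n>0. x [^] (n::nat) = \<one>)" for x
  proof (cases "x \<in> H")
    case True
    then have "x \<in> carrier G" using H subgroup.mem_carrier by fast
    then show ?thesis using True pow_ord_eq_1[of x] pow_eq_id[of x]
      by (auto simp: finite_order_elements_def)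
  qed (simp add: finite_order_elements_def)
  have sub: "subgroup ?K G"
  proof
    show "?K \<subseteq> carrier G" using H subgroup.subset by (auto simp: finite_order_elements_def)
    show "\<one> \<in> ?K" using H subgroup.one_closed by (auto simp: mem intro: exI[of _ 1])
    fix x assume x: "x \<in> ?K"
    then obtain n where n: "x \<in> H" "n > 0" "x [^] (n::nat) = \<one>" by (auto simp: mem)
    have xG: "x \<in> carrier G" using n(1) H subgroup.mem_carrier by fast
    have "inv x [^] n = \<one>" using n(3) xG by (simp add: nat_pow_inv)
    then show "inv x \<in> ?K" using n H subgroup.m_inv_closed by (auto simp: mem)
    fix y assume y: "y \<in> ?K"
    then obtain m where m: "y \<in> H" "m > 0" "y [^] (m::nat) = \<one>" by (auto simp: mem)
    have yG: "y \<in> carrier G" using m(1) H subgroup.mem_carrier by fast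
    have "x \<otimes> y = y \<otimes> x" using comm n m by blast
    then have "(x \<otimes> y) [^] (n * m) = x [^] (n * m) \<otimes> y [^] (n * m)"
      using xG yG by (intro pow_mult_distrib)
    also have "\<dots> = \<one>"
      using n(3) m(3) xG yG by (simp add: nat_pow_pow[symmetric]) (metis mult.commute nat_pow_one nat_pow_pow)
    finally show "x \<otimes> y \<in> ?K" using n m H subgroup.m_closed by (auto simp: mem intro!: exI[of _ "n * m"])
  qed
  then have "group (G\<lparr>carrier := ?K\<rparr>)" by (rule subgroup.subgroup_is_group) (rule is_group)
  then show ?thesis
    by (rule group.group_comm_groupI) (use comm in \<open>auto simp: mem\<close>)
qed

theorem theorem2:
  fixes G :: "('g, 'm) monoid_scheme"
    and lam :: "'g \<Rightarrow> 'g \<Rightarrow> 'k::field"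
  defines "U \<equiv> units_of (twisted_group_algebra G lam)"
  assumes "group G"
    and "two_cocycle G lam"
    and "infinite (carrier (twisted_group_algebra G lam))"
    and "\<And>g. g \<in> FC_center G \<Longrightarrow> group.ord G g \<noteq> 0 \<Longrightarrow> \<not> CHAR('k) dvd group.ord G g"
  shows "comm_group (U\<lparr>carrier := finite_order_elements U (FC_center U)\<rparr>)"
proof -
  interpret group G by fact
  interpret twisted G lam by unfold_locales fact
  interpret U: group U unfolding U_def by (rule group_U)
  show ?thesis
  proof (rule U.comm_group_torsion[OF U.FC_center_subgroup])
    fix x y and n m :: nat
    assume "x \<in> FC_center U" "y \<in> FC_center U" "x [^]\<^bsub>U\<^esub> n = \<one>\<^bsub>U\<^esub>" "y [^]\<^bsub>U\<^esub> m = \<one>\<^bsub>U\<^esub>" "n > 0" "m > 0"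
    then show "x \<otimes>\<^bsub>U\<^esub> y = y \<otimes>\<^bsub>U\<^esub> x"
      using torsion_FC_commute[OF assms(4), of x n y m] by (simp add: U_def U_simps)
  qed
qed

end
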